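(* For $g\in L^2(\mathbb R)$, $a,b>0$ and $n\in\mathbb Z$ let $V_n:=\overline{\operatorname{span}}\{E_{mb}T_{na}g\}_{m\in\mathbb Z}\subseteq L^2(\mathbb R)$. (i) For each integer $N\ge2$ there exist $a,b>0$ and $g\in L^2(\mathbb R)$ such that $\{E_{mb}T_{na}g\}_{m,n\in\mathbb Z}$ is a frame for $L^2(\mathbb R)$ and the $N$ collections of subspaces $$\{V_{Nn}\}_{n\in\mathbb Z},\ \{V_{Nn+1}\}_{n\in\mathbb Z},\ \dots,\ \{V_{Nn+N-1}\}_{n\in\mathbb Z}$$ are woven information packets in $L^2(\mathbb R)$. (ii) There do not exist $a,b>0$ and $g\in L^2(\mathbb R)$ such that $\{E_{mb}T_{na}g\}_{m,n\in\mathbb Z}$ is a frame for $L^2(\mathbb R)$ and, simultaneously for all integers $N\ge2$, the $N$ collections $\{V_{Nn}\}_{n\in\mathbb Z},\{V_{Nn+1}\}_{n\in\mathbb Z},\dots,\{V_{Nn+N-1}\}_{n\in\mathbb Z}$ are woven information packets in $L^2(\mathbb R)$.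
   Context: Gabor systems: $E_{mb}T_{na}g(x):=e^{2\pi i mbx}g(x-na)$. The notation $\overline{\operatorname{span}}$ denotes the closed linear span. Information packet: a family $\{W_j\}_{j\in J}$ of closed subspaces of a Hilbert space $\mathcal H$ is an information packet if each $f\in\mathcal H$ has an unconditionally convergent expansion $f=\sum_{j\in J}f_j$ with $f_j\in W_j$ for all $j\in J$. Woven: $N$ information packets $\{W_j^{(\ell)}\}_{j\in J}$, $\ell=1,\dots,N$, are woven if for each partition $\{\sigma_k\}_{k=1}^N$ of $J$ (parts may be empty), the family $\{W_j^{(1)}\}_{j\in\sigma_1}\cup\cdots\cup\{W_j^{(N)}\}_{j\in\sigma_N}$ is an information packet. Equivalently, for every choice of $\ell_j\in\{1,\dots,N\}$, $j\in J$, the family $\{W_j^{(\ell_j)}\}_{j\in J}$ is an information packet. In the claim, $J=\mathbb Z$ and $W_n^{(\ell)}=V_{Nn+\ell-1}$. *)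

theory Defs
  imports "HOL-Analysis.Analysis"
begin

text \<open>
  Elements of the complex Hilbert space of square integrable functions on the real line are
  represented by functions; two functions represent the same element iff they agree almost
  everywhere, i.e. iff their difference has norm 0. All notions below are invariant under this
  identification.
\<close>

definition L2 :: "(real \<Rightarrow> complex) set" where
  "L2 = {f. f \<in> borel_measurable lborel \<and> integrable lborel (\<lambda>x. (cmod (f x))\<^sup>2)}"

definition l2_inner :: "(real \<Rightarrow> complex) \<Rightarrow> (real \<Rightarrow> complex) \<Rightarrow> complex" where
  "l2_inner f g = (LINT x|lborel. f x * cnj (g x))"

definition l2_norm :: "(real \<Rightarrow> complex) \<Rightarrow> real" where
  "l2_norm f = sqrt (LINT x|lborel. (cmod (f x))\<^sup>2)"

definition l2_closure :: "(real \<Rightarrow> complex) set \<Rightarrow> (real \<Rightarrow> complex) set" where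
  "l2_closure S = {f \<in> L2. \<forall>e>0. \<exists>h\<in>S. l2_norm (\<lambda>x. f x - h x) < e}"

definition lin_span :: "(real \<Rightarrow> complex) set \<Rightarrow> (real \<Rightarrow> complex) set" where
  "lin_span S = {(\<lambda>x. \<Sum>u\<in>F. c u * u x) | F c. finite F \<and> F \<subseteq> S}"

definition closed_span :: "(real \<Rightarrow> complex) set \<Rightarrow> (real \<Rightarrow> complex) set" where
  "closed_span S = l2_closure (lin_span S)"

text \<open>Closedness includes that a closed subspace contains, with a function, every function
  of \<^const>\<open>L2\<close> that agrees with it almost everywhere.\<close>

definition closed_subspace :: "(real \<Rightarrow> complex) set \<Rightarrow> bool" where
  "closed_subspace W \<longleftrightarrow>
     W \<subseteq> L2 \<and> (\<lambda>x. 0) \<in> W \<and>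
     (\<forall>f\<in>W. \<forall>h\<in>W. (\<lambda>x. f x + h x) \<in> W) \<and>
     (\<forall>c. \<forall>f\<in>W. (\<lambda>x. c * f x) \<in> W) \<and>
     l2_closure W \<subseteq> W"

definition is_frame :: "'i set \<Rightarrow> ('i \<Rightarrow> real \<Rightarrow> complex) \<Rightarrow> bool" where
  "is_frame I \<phi> \<longleftrightarrow>
     (\<forall>i\<in>I. \<phi> i \<in> L2) \<and>
     (\<exists>A>0. \<exists>B>0. \<forall>f\<in>L2.
        (\<lambda>i. (cmod (l2_inner f (\<phi> i)))\<^sup>2) summable_on I \<and>
        A * (l2_norm f)\<^sup>2 \<le> (\<Sum>\<^sub>\<infinity>i\<in>I. (cmod (l2_inner f (\<phi> i)))\<^sup>2) \<and>
        (\<Sum>\<^sub>\<infinity>i\<in>I. (cmod (l2_inner f (\<phi> i)))\<^sup>2) \<le> B * (l2_norm f)\<^sup>2)"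

text \<open>Unconditional convergence in norm: the net of finite partial sums converges, as in
  \<^const>\<open>has_sum\<close>.\<close>

definition l2_has_sum :: "('i \<Rightarrow> real \<Rightarrow> complex) \<Rightarrow> (real \<Rightarrow> complex) \<Rightarrow> 'i set \<Rightarrow> bool" where
  "l2_has_sum u f J \<longleftrightarrow>
     ((\<lambda>F. l2_norm (\<lambda>x. f x - (\<Sum>j\<in>F. u j x))) \<longlongrightarrow> 0) (finite_subsets_at_top J)"

definition information_packet :: "'i set \<Rightarrow> ('i \<Rightarrow> (real \<Rightarrow> complex) set) \<Rightarrow> bool" where
  "information_packet J W \<longleftrightarrow>
     (\<forall>j\<in>J. closed_subspace (W j)) \<and>
     (\<forall>f\<in>L2. \<exists>u. (\<forall>j\<in>J. u j \<in> W j) \<and> l2_has_sum u f J)"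

text \<open>The union of the families \<open>W k\<close> restricted to the parts \<open>\<sigma> k\<close> is the family indexed by
  the disjoint sum of the parts.\<close>

definition woven :: "nat \<Rightarrow> 'i set \<Rightarrow> (nat \<Rightarrow> 'i \<Rightarrow> (real \<Rightarrow> complex) set) \<Rightarrow> bool" where
  "woven N J W \<longleftrightarrow>
     (\<forall>k\<in>{1..N}. information_packet J (W k)) \<and>
     (\<forall>\<sigma>. disjoint_family_on \<sigma> {1..N} \<and> (\<Union>k\<in>{1..N}. \<sigma> k) = J \<longrightarrow>
        information_packet (Sigma {1..N} \<sigma>) (\<lambda>(k, j). W k j))"

definition modulation :: "real \<Rightarrow> (real \<Rightarrow> complex) \<Rightarrow> real \<Rightarrow> complex" where
  "modulation s f = (\<lambda>x. exp (2 * complex_of_real pi * \<i> * complex_of_real (s * x)) * f x)"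

definition translation :: "real \<Rightarrow> (real \<Rightarrow> complex) \<Rightarrow> real \<Rightarrow> complex" where
  "translation t f = (\<lambda>x. f (x - t))"

definition gabor :: "(real \<Rightarrow> complex) \<Rightarrow> real \<Rightarrow> real \<Rightarrow> int \<Rightarrow> int \<Rightarrow> real \<Rightarrow> complex" where
  "gabor g a b m n = modulation (of_int m * b) (translation (of_int n * a) g)"

definition gabor_frame :: "(real \<Rightarrow> complex) \<Rightarrow> real \<Rightarrow> real \<Rightarrow> bool" where
  "gabor_frame g a b \<longleftrightarrow> is_frame UNIV (\<lambda>(m, n). gabor g a b m n)"

definition V :: "(real \<Rightarrow> complex) \<Rightarrow> real \<Rightarrow> real \<Rightarrow> int \<Rightarrow> (real \<Rightarrow> complex) set" where
  "V g a b n = closed_span (range (\<lambda>m. gabor g a b m n))"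

end

(*
  Part (ii): choose N with N a b > 1. The single packet {V_{Nn}} already makes the Bessel system
  {E_{mb} T_{nNa} g} complete, which the density theorem forbids. With frame operator S, bound B and
  T = 1 - S / B, the functions gamma_k = (1/B) sum_{j<k} T^j g are approximate duals of g:
  <gamma_k, g> <= 1, T^k -> 0 weakly by completeness, and evaluating
  1 - T^k = sum <., E T g> E T gamma_k on indicators of short intervals tiling [0, Na) gives
  <gamma_k, g> / b -> Na, so Na b <= 1. The bounded powers of T replace the
  inverse square root of S used in the classical argument.

  Part (i): for a = 1, b = 1/(2N) and g the indicator of [0, 2N), V_n consists of the functions
  supported in [n, n + 2N), and two consecutive selected windows start less than 2N apart.
*)
theory Submission
  imports Defs
begin


text \<open>In (ii) the thinned system inherits only the upper bound from the frame, and a packet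
  yields only density of the span, with no control on coefficients. So S may fail to be bounded
  below, and an exact dual window in L2 need not exist: every estimate is proved for finite k and
  then passed to the limit. The functions gamma_k are partial sums of the Neumann series for the
  inverse of S. The decay of T^k comes from moments: <T^k g, g> is nonnegative and decreasing in k
  with partial sums at most B, hence O(1/k). S commutes with the time-frequency shifts of the
  lattice, so one window gamma_k serves all Gabor elements. Summing over modulations is Parseval on
  an interval of length at most 1/b; summing over translations then collects the integral over the
  whole line, because the shifted cells tile it. In (i) the length 2N leaves, wherever the window
  starts among N consecutive positions, a full block of length N whose place does not depend on the
  choice. There N a b = 1/2, within the bound found in (ii).\<close>

lemma borel_measurable_cnj [measurable]: "cnj \<in> borel_measurable borel"
  by (intro borel_measurable_continuous_onI continuous_intros)

section \<open>The space of square integrable functions\<close>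

lemma L2_D:
  assumes "f \<in> L2"
  shows "f \<in> borel_measurable borel" "integrable lborel (\<lambda>x. (cmod (f x))\<^sup>2)"
  using assms by (auto simp: L2_def)

lemma L2_I:
  assumes "f \<in> borel_measurable borel" "integrable lborel (\<lambda>x. (cmod (f x))\<^sup>2)"
  shows "f \<in> L2"
  using assms by (auto simp: L2_def)

lemma L2_bound:
  assumes "h \<in> L2" "f \<in> borel_measurable borel" "\<And>x. cmod (f x) \<le> cmod (h x)"
  shows "f \<in> L2"
proof (rule L2_I)
  show "integrable lborel (\<lambda>x. (cmod (f x))\<^sup>2)"
    by (rule Bochner_Integration.integrable_bound[OF L2_D(2)[OF assms(1)]])
       (use assms in \<open>auto intro!: power_mono\<close>)
qed (use assms in auto)

lemma L2_zero [simp]: "(\<lambda>x. 0) \<in> L2"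
  by (auto simp: L2_def)

lemma L2_add:
  assumes "f \<in> L2" "h \<in> L2"
  shows "(\<lambda>x. f x + h x) \<in> L2"
proof (rule L2_I)
  note [measurable] = L2_D(1)[OF assms(1)] L2_D(1)[OF assms(2)]
  show "(\<lambda>x. f x + h x) \<in> borel_measurable borel" by measurable
  have *: "(cmod (x + y))\<^sup>2 \<le> 2 * (cmod x)\<^sup>2 + 2 * (cmod y)\<^sup>2" for x y :: complex
  proof -
    have "(cmod (x + y))\<^sup>2 \<le> (cmod x + cmod y)\<^sup>2"
      by (intro power_mono norm_triangle_ineq) auto
    also have "\<dots> \<le> 2 * (cmod x)\<^sup>2 + 2 * (cmod y)\<^sup>2"
      using sum_squares_bound[of "cmod x" "cmod y"] by (simp add: power2_sum)
    finally show ?thesis .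
  qed
  show "integrable lborel (\<lambda>x. (cmod (f x + h x))\<^sup>2)"
    by (rule Bochner_Integration.integrable_bound
          [of _ "\<lambda>x. 2 * (cmod (f x))\<^sup>2 + 2 * (cmod (h x))\<^sup>2"])
       (use L2_D(2)[OF assms(1)] L2_D(2)[OF assms(2)] * in auto)
qed

lemma L2_scale:
  assumes "f \<in> L2"
  shows "(\<lambda>x. c * f x) \<in> L2"
  using assms by (auto simp: L2_def norm_mult power_mult_distrib)

lemma L2_diff:
  assumes "f \<in> L2" "h \<in> L2"
  shows "(\<lambda>x. f x - h x) \<in> L2"
  using L2_add[OF assms(1) L2_scale[OF assms(2), of "-1"]] by simp

lemma L2_sum:
  assumes "\<And>i. i \<in> F \<Longrightarrow> u i \<in> L2"
  shows "(\<lambda>x. \<Sum>i\<in>F. u i x) \<in> L2"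
  using assms by (induction F rule: infinite_finite_induct) (auto intro: L2_add)

lemma L2_integrable_prod:
  assumes "f \<in> L2" "h \<in> L2"
  shows "integrable lborel (\<lambda>x. f x * cnj (h x))"
proof (rule Bochner_Integration.integrable_bound[of _ "\<lambda>x. (cmod (f x))\<^sup>2 + (cmod (h x))\<^sup>2"])
  note [measurable] = L2_D(1)[OF assms(1)] L2_D(1)[OF assms(2)]
  show "integrable lborel (\<lambda>x. (cmod (f x))\<^sup>2 + (cmod (h x))\<^sup>2)"
    using assms by (auto dest: L2_D)
  show "(\<lambda>x. f x * cnj (h x)) \<in> borel_measurable lborel"
    by (auto intro!: borel_measurable_times measurable_compose[OF _ borel_measurable_cnj])
  have "cmod x * cmod y \<le> (cmod x)\<^sup>2 + (cmod y)\<^sup>2" for x y :: complex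
  proof -
    have "0 \<le> cmod x * cmod y" by simp
    then show ?thesis using sum_squares_bound[of "cmod x" "cmod y"] by linarith
  qed
  then show "AE x in lborel. norm (f x * cnj (h x)) \<le> norm ((cmod (f x))\<^sup>2 + (cmod (h x))\<^sup>2)"
    by (auto simp: norm_mult)
qed

section \<open>Inner product and norm\<close>

lemma l2_inner_commute: "l2_inner f h = cnj (l2_inner h f)"
  unfolding l2_inner_def by (subst Bochner_Integration.integral_cnj[symmetric]) (simp add: mult.commute)

lemma l2_inner_add_left:
  assumes "f \<in> L2" "h \<in> L2" "k \<in> L2"
  shows "l2_inner (\<lambda>x. f x + h x) k = l2_inner f k + l2_inner h k"
  unfolding l2_inner_def distrib_right
  using assms by (intro Bochner_Integration.integral_add L2_integrable_prod)

lemma l2_inner_scale_left: "l2_inner (\<lambda>x. c * f x) k = c * l2_inner f k"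
  unfolding l2_inner_def mult.assoc by simp

lemma l2_inner_diff_left:
  assumes "f \<in> L2" "h \<in> L2" "k \<in> L2"
  shows "l2_inner (\<lambda>x. f x - h x) k = l2_inner f k - l2_inner h k"
  unfolding l2_inner_def left_diff_distrib
  using assms by (intro Bochner_Integration.integral_diff L2_integrable_prod)

lemma l2_inner_sum_left:
  assumes "\<And>i. i \<in> F \<Longrightarrow> u i \<in> L2" "k \<in> L2"
  shows "l2_inner (\<lambda>x. \<Sum>i\<in>F. u i x) k = (\<Sum>i\<in>F. l2_inner (u i) k)"
  unfolding l2_inner_def sum_distrib_right
  using assms by (intro Bochner_Integration.integral_sum L2_integrable_prod)

lemma l2_inner_add_right:
  assumes "f \<in> L2" "h \<in> L2" "k \<in> L2"
  shows "l2_inner k (\<lambda>x. f x + h x) = l2_inner k f + l2_inner k h"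
  by (subst (1 2 3) l2_inner_commute) (simp add: l2_inner_add_left assms)

lemma l2_inner_scale_right: "l2_inner k (\<lambda>x. c * f x) = cnj c * l2_inner k f"
  by (subst (1 2) l2_inner_commute) (simp add: l2_inner_scale_left)

lemma l2_inner_diff_right:
  assumes "f \<in> L2" "h \<in> L2" "k \<in> L2"
  shows "l2_inner k (\<lambda>x. f x - h x) = l2_inner k f - l2_inner k h"
  by (subst (1 2 3) l2_inner_commute) (simp add: l2_inner_diff_left assms)

lemma l2_inner_sum_right:
  assumes "\<And>i. i \<in> F \<Longrightarrow> u i \<in> L2" "k \<in> L2"
  shows "l2_inner k (\<lambda>x. \<Sum>i\<in>F. u i x) = (\<Sum>i\<in>F. l2_inner k (u i))"
proof -
  have "l2_inner k (\<lambda>x. \<Sum>i\<in>F. u i x) = cnj (\<Sum>i\<in>F. l2_inner (u i) k)"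
    by (subst l2_inner_commute) (simp add: l2_inner_sum_left assms)
  also have "\<dots> = (\<Sum>i\<in>F. l2_inner k (u i))"
    by (simp add: l2_inner_commute[of k])
  finally show ?thesis .
qed

lemma l2_norm_nonneg [simp]: "0 \<le> l2_norm f"
  by (simp add: l2_norm_def)

lemma l2_norm_sq: "(l2_norm f)\<^sup>2 = (LINT x|lborel. (cmod (f x))\<^sup>2)"
  by (simp add: l2_norm_def)

lemma l2_inner_self: "l2_inner f f = of_real ((l2_norm f)\<^sup>2)"
  unfolding l2_norm_sq l2_inner_def
  by (simp flip: integral_complex_of_real add: complex_norm_square[symmetric])

lemma Re_l2_inner_self: "Re (l2_inner f f) = (l2_norm f)\<^sup>2"
  by (simp add: l2_inner_self)

lemma l2_norm_diff_sq:
  assumes "f \<in> L2" "h \<in> L2"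
  shows "(l2_norm (\<lambda>x. f x - h x))\<^sup>2 = (l2_norm f)\<^sup>2 - 2 * Re (l2_inner f h) + (l2_norm h)\<^sup>2"
proof -
  have "(l2_norm (\<lambda>x. f x - h x))\<^sup>2
      = Re (l2_inner f f - l2_inner f h - (l2_inner h f - l2_inner h h))"
    unfolding Re_l2_inner_self[symmetric]
    using assms by (simp add: l2_inner_diff_left l2_inner_diff_right L2_diff)
  also have "Re (l2_inner h f) = Re (l2_inner f h)"
    by (subst l2_inner_commute) simp
  ultimately show ?thesis by (simp add: l2_inner_self)
qed

lemma l2_norm_scale: "l2_norm (\<lambda>x. c * f x) = cmod c * l2_norm f"
  by (simp add: l2_norm_def norm_mult power_mult_distrib real_sqrt_mult)

lemma l2_norm_minus_commute: "l2_norm (\<lambda>x. f x - h x) = l2_norm (\<lambda>x. h x - f x)"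
  by (simp add: l2_norm_def norm_minus_commute)

text \<open>The squared norm of f - s z h is nonnegative for real s and z = <f, h>. The factor z
  makes the mixed term real, so a real quadratic in s remains.\<close>

lemma l2_Cauchy_Schwarz:
  assumes "f \<in> L2" "h \<in> L2"
  shows "cmod (l2_inner f h) \<le> l2_norm f * l2_norm h"
proof -
  define z where "z = l2_inner f h"
  have *: "0 \<le> (l2_norm f)\<^sup>2 - 2 * s * (cmod z)\<^sup>2 + s\<^sup>2 * (cmod z)\<^sup>2 * (l2_norm h)\<^sup>2" for s
  proof -
    have "0 \<le> (l2_norm (\<lambda>x. f x - of_real s * z * h x))\<^sup>2" by simp
    also have "\<dots> = (l2_norm f)\<^sup>2 - 2 * Re (cnj (of_real s * z) * z)
                 + (cmod (of_real s * z) * l2_norm h)\<^sup>2"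
      by (subst l2_norm_diff_sq)
         (use assms in \<open>simp_all add: L2_scale l2_norm_scale l2_inner_scale_right z_def\<close>)
    also have "cnj (of_real s * z) * z = of_real (s * (cmod z)\<^sup>2)"
      by (simp add: complex_norm_square[symmetric] mult.commute mult.left_commute
               flip: of_real_power)
    finally show ?thesis by (simp add: norm_mult power_mult_distrib)
  qed
  have "(cmod z)\<^sup>2 \<le> (l2_norm f * l2_norm h)\<^sup>2"
  proof (cases "l2_norm h = 0")
    \<comment> \<open>Norm 0 does not make h vanish pointwise. The quadratic degenerates to an
      affine function of s, and the chosen s would give it the value -1 if z were nonzero.\<close>
    case True
    have "(cmod z)\<^sup>2 \<le> 0"
    proof (rule ccontr)
      assume "\<not> (cmod z)\<^sup>2 \<le> 0"
      then show False
        using *[of "((l2_norm f)\<^sup>2 + 1) / (2 * (cmod z)\<^sup>2)"] True by (simp add: field_simps)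
    qed
    then show ?thesis by (simp add: True)
  next
    case False
    then have pos: "(l2_norm h)\<^sup>2 > 0" by simp
    have "0 \<le> (l2_norm f)\<^sup>2 - (cmod z)\<^sup>2 / (l2_norm h)\<^sup>2"
    proof -
      have "(1 / n)\<^sup>2 * y * n = y / n" if "n > 0" for n y :: real
        using that by (simp add: power2_eq_square)
      from this[OF pos] show ?thesis
        using *[of "1 / (l2_norm h)\<^sup>2"] by simp
    qed
    then show ?thesis
      using pos by (simp add: field_simps power_mult_distrib)
  qed
  then show ?thesis
    unfolding z_def by (rule power2_le_imp_le) simp
qed

lemma l2_norm_triangle:
  assumes "f \<in> L2" "h \<in> L2"
  shows "l2_norm (\<lambda>x. f x + h x) \<le> l2_norm f + l2_norm h"
proof (rule power2_le_imp_le)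
  have "(l2_norm (\<lambda>x. f x + h x))\<^sup>2 = (l2_norm (\<lambda>x. f x - (-1) * h x))\<^sup>2" by simp
  also have "\<dots> = (l2_norm f)\<^sup>2 + 2 * Re (l2_inner f h) + (l2_norm h)\<^sup>2"
    by (subst l2_norm_diff_sq)
       (use assms L2_scale[of h "-1"] l2_inner_scale_right[of f "-1" h] l2_norm_scale[of "-1" h]
         in simp_all)
  also have "\<dots> \<le> (l2_norm f)\<^sup>2 + 2 * (l2_norm f * l2_norm h) + (l2_norm h)\<^sup>2"
    using l2_Cauchy_Schwarz[OF assms] complex_Re_le_cmod[of "l2_inner f h"] by simp
  finally show "(l2_norm (\<lambda>x. f x + h x))\<^sup>2 \<le> (l2_norm f + l2_norm h)\<^sup>2"
    by (simp add: power2_sum algebra_simps)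
qed simp

lemma l2_norm_triangle3:
  assumes "f \<in> L2" "h \<in> L2" "k \<in> L2"
  shows "l2_norm (\<lambda>x. f x - k x) \<le> l2_norm (\<lambda>x. f x - h x) + l2_norm (\<lambda>x. h x - k x)"
  using l2_norm_triangle[OF L2_diff[OF assms(1,2)] L2_diff[OF assms(2,3)]] by simp

lemma l2_norm_sum_le:
  assumes "\<And>i. i \<in> F \<Longrightarrow> u i \<in> L2"
  shows "l2_norm (\<lambda>x. \<Sum>i\<in>F. u i x) \<le> (\<Sum>i\<in>F. l2_norm (u i))"
  using assms
proof (induction F rule: infinite_finite_induct)
  case (insert i F)
  then show ?case
    using l2_norm_triangle[OF _ L2_sum, of "u i" F u] by fastforce
qed (simp_all add: l2_norm_def)

section \<open>Spans and closures\<close>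

lemma lin_span_base: "u \<in> S \<Longrightarrow> u \<in> lin_span S"
  unfolding lin_span_def by (rule CollectI, rule exI[of _ "{u}"], rule exI[of _ "\<lambda>_. 1"]) auto

lemma lin_span_zero: "(\<lambda>x. 0) \<in> lin_span S"
  unfolding lin_span_def by (rule CollectI, rule exI[of _ "{}"]) auto

lemma lin_span_mono: "S \<subseteq> S' \<Longrightarrow> lin_span S \<subseteq> lin_span S'"
  unfolding lin_span_def by blast

lemma lin_span_add:
  assumes "f \<in> lin_span S" "h \<in> lin_span S"
  shows "(\<lambda>x. f x + h x) \<in> lin_span S"
proof -
  obtain F c F' c' where F: "finite F" "F \<subseteq> S" "f = (\<lambda>x. \<Sum>u\<in>F. c u * u x)"
    and F': "finite F'" "F' \<subseteq> S" "h = (\<lambda>x. \<Sum>u\<in>F'. c' u * u x)"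
    using assms unfolding lin_span_def by blast
  \<comment> \<open>The two finite sets may overlap, so both coefficient functions are extended by
    zero to the union.\<close>
  define d where "d u = (if u \<in> F then c u else 0) + (if u \<in> F' then c' u else 0)" for u
  have "f x = (\<Sum>u\<in>F \<union> F'. (if u \<in> F then c u else 0) * u x)" for x
    unfolding F(3) by (rule sum.mono_neutral_cong_left) (use F F' in auto)
  moreover have "h x = (\<Sum>u\<in>F \<union> F'. (if u \<in> F' then c' u else 0) * u x)" for x
    unfolding F'(3) by (rule sum.mono_neutral_cong_left) (use F F' in auto)
  ultimately have "(\<lambda>x. f x + h x) = (\<lambda>x. \<Sum>u\<in>F \<union> F'. d u * u x)"
    by (simp add: d_def distrib_right sum.distrib)
  then show ?thesis
    unfolding lin_span_def using F F' by (intro CollectI exI[of _ "F \<union> F'"] exI[of _ d]) auto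
qed

lemma lin_span_scale:
  assumes "f \<in> lin_span S"
  shows "(\<lambda>x. c * f x) \<in> lin_span S"
proof -
  obtain F d where F: "finite F" "F \<subseteq> S" "f = (\<lambda>x. \<Sum>u\<in>F. d u * u x)"
    using assms unfolding lin_span_def by blast
  then show ?thesis
    unfolding lin_span_def
    by (intro CollectI exI[of _ F] exI[of _ "\<lambda>u. c * d u"]) (auto simp: sum_distrib_left mult.assoc)
qed

lemma lin_span_sum:
  assumes "\<And>i. i \<in> F \<Longrightarrow> u i \<in> lin_span S"
  shows "(\<lambda>x. \<Sum>i\<in>F. u i x) \<in> lin_span S"
  using assms by (induction F rule: infinite_finite_induct) (auto intro: lin_span_add lin_span_zero)

lemma lin_span_L2:
  assumes "S \<subseteq> L2" "f \<in> lin_span S"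
  shows "f \<in> L2"
  using assms unfolding lin_span_def by (auto intro!: L2_sum L2_scale)

lemma l2_closure_approx:
  assumes "f \<in> l2_closure S" "e > 0"
  obtains h where "h \<in> S" "l2_norm (\<lambda>x. f x - h x) < e"
  using assms by (auto simp: l2_closure_def)

lemma closed_span_approx:
  assumes "f \<in> closed_span S" "e > 0"
  obtains h where "h \<in> lin_span S" "l2_norm (\<lambda>x. f x - h x) < e"
  using assms l2_closure_approx unfolding closed_span_def by blast

lemma closed_subspace_closed_span:
  assumes S: "S \<subseteq> L2"
  shows "closed_subspace (closed_span S)"
  unfolding closed_subspace_def
proof (intro conjI ballI allI)
  show "closed_span S \<subseteq> L2" by (auto simp: closed_span_def l2_closure_def)
  show "(\<lambda>x. 0) \<in> closed_span S"
    unfolding closed_span_def l2_closure_def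
    by (auto intro!: bexI[OF _ lin_span_zero] simp: l2_norm_def)
next
  fix f h assume f: "f \<in> closed_span S" and h: "h \<in> closed_span S"
  have L2: "f \<in> L2" "h \<in> L2" using f h by (auto simp: closed_span_def l2_closure_def)
  show "(\<lambda>x. f x + h x) \<in> closed_span S"
    unfolding closed_span_def l2_closure_def
  proof (intro CollectI conjI allI impI)
    fix e :: real assume "e > 0"
    then have e: "e / 2 > 0" by simp
    obtain f' where f': "f' \<in> lin_span S" "l2_norm (\<lambda>x. f x - f' x) < e / 2"
      by (rule closed_span_approx[OF f e])
    obtain h' where h': "h' \<in> lin_span S" "l2_norm (\<lambda>x. h x - h' x) < e / 2"
      by (rule closed_span_approx[OF h e])
    note L2' = lin_span_L2[OF S f'(1)] lin_span_L2[OF S h'(1)]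
    have "l2_norm (\<lambda>x. f x + h x - (f' x + h' x)) = l2_norm (\<lambda>x. (f x - f' x) + (h x - h' x))"
      by (simp add: algebra_simps)
    also have "\<dots> \<le> l2_norm (\<lambda>x. f x - f' x) + l2_norm (\<lambda>x. h x - h' x)"
      using L2 L2' by (intro l2_norm_triangle L2_diff)
    also have "\<dots> < e" using f' h' by simp
    finally show "\<exists>k\<in>lin_span S. l2_norm (\<lambda>x. f x + h x - k x) < e"
      using lin_span_add[OF f'(1) h'(1)] by (intro bexI[of _ "\<lambda>x. f' x + h' x"])
  qed (use L2 L2_add in auto)
next
  fix c f assume f: "f \<in> closed_span S"
  have L2: "f \<in> L2" using f by (auto simp: closed_span_def l2_closure_def)
  show "(\<lambda>x. c * f x) \<in> closed_span S"
    unfolding closed_span_def l2_closure_def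
  proof (intro CollectI conjI allI impI)
    fix e :: real assume "e > 0"
    \<comment> \<open>The summand 1 covers the case c = 0.\<close>
    then have "e / (cmod c + 1) > 0" by (simp add: add_nonneg_pos)
    then obtain f' where f': "f' \<in> lin_span S" "l2_norm (\<lambda>x. f x - f' x) < e / (cmod c + 1)"
      by (rule closed_span_approx[OF f])
    have "l2_norm (\<lambda>x. c * f x - c * f' x) = cmod c * l2_norm (\<lambda>x. f x - f' x)"
      by (simp flip: l2_norm_scale add: algebra_simps)
    also have "\<dots> \<le> (cmod c + 1) * l2_norm (\<lambda>x. f x - f' x)"
      by (simp add: mult_right_mono)
    also have "\<dots> < e" using f'(2) by (subst mult.commute) (simp add: pos_less_divide_eq add_nonneg_pos)
    finally show "\<exists>k\<in>lin_span S. l2_norm (\<lambda>x. c * f x - k x) < e"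
      using lin_span_scale[OF f'(1)] by (intro bexI[of _ "\<lambda>x. c * f' x"])
  qed (use L2 L2_scale in auto)
next
  show "l2_closure (closed_span S) \<subseteq> closed_span S"
  proof
    fix f assume f: "f \<in> l2_closure (closed_span S)"
    then have fL: "f \<in> L2" by (auto simp: l2_closure_def)
    show "f \<in> closed_span S"
      unfolding closed_span_def l2_closure_def
    proof (intro CollectI conjI allI impI)
      fix e :: real assume "e > 0"
      then have e: "e / 2 > 0" by simp
      obtain h where h: "h \<in> closed_span S" "l2_norm (\<lambda>x. f x - h x) < e / 2"
        by (rule l2_closure_approx[OF f e])
      obtain k where k: "k \<in> lin_span S" "l2_norm (\<lambda>x. h x - k x) < e / 2"
        by (rule closed_span_approx[OF h(1) e])
      have "h \<in> L2" using h by (auto simp: closed_span_def l2_closure_def)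
      then have "l2_norm (\<lambda>x. f x - k x) < e"
        using l2_norm_triangle3[OF fL _ lin_span_L2[OF S k(1)], of h] h k by simp
      then show "\<exists>k\<in>lin_span S. l2_norm (\<lambda>x. f x - k x) < e" using k by blast
    qed fact
  qed
qed

section \<open>Decomposition of the line into intervals\<close>

text \<open>Turns an unconditional sum over the integers into the limit of a sequence, the form in
  which dominated convergence applies.\<close>

lemma filterlim_symmetric_intervals:
  "filterlim (\<lambda>k::nat. {- int k..int k}) (finite_subsets_at_top UNIV) sequentially"
  unfolding filterlim_finite_subsets_at_top
proof (intro allI impI)
  fix X :: "int set" assume X: "finite X \<and> X \<subseteq> UNIV"
  then obtain M where M: "\<And>x. x \<in> X \<Longrightarrow> \<bar>x\<bar> \<le> M"
    by (metis finite_imageI finite_nat_iff_bounded_le Max_ge imageI)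
  show "\<forall>\<^sub>F k in sequentially. finite {- int k..int k} \<and> X \<subseteq> {- int k..int k} \<and> {- int k..int k} \<subseteq> UNIV"
    using eventually_ge_at_top[of "nat M"]
  proof eventually_elim
    case (elim k)
    have "x \<in> {- int k..int k}" if "x \<in> X" for x
      using M[OF that] elim by (auto simp: abs_le_iff)
    then show ?case by auto
  qed
qed

lemma floor_interval_iff:
  fixes a x :: real
  assumes "a > 0"
  shows "x \<in> {of_int n * a..<of_int n * a + a} \<longleftrightarrow> n = \<lfloor>x / a\<rfloor>"
  using assms by (auto simp: floor_eq_iff field_simps eq_commute[of n])

text \<open>Finite partial sums of the norms are bounded by the L1 norm of F, which gives
  unconditional summability. The value is then identified along symmetric partial sums by dominated
  convergence.\<close>

lemma has_sum_integral_intervals: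
  fixes F :: "real \<Rightarrow> 'a::{banach, second_countable_topology}"
  assumes F: "integrable lborel F" and a: "a > 0"
  shows "((\<lambda>n::int. LINT x:{of_int n * a..<of_int n * a + a}|lborel. F x) has_sum
          (LINT x|lborel. F x)) UNIV"
proof -
  define D where "D n = {of_int n * a..<of_int n * a + a}" for n :: int
  \<comment> \<open>The intervals are disjoint, so at x only the term with index floor(x / a)
    survives.\<close>
  have ind: "(\<Sum>n\<in>X. indicator (D n) x *\<^sub>R G x) = (if \<lfloor>x / a\<rfloor> \<in> X then G x else 0)"
    if "finite X" for X x and G :: "real \<Rightarrow> 'b::real_vector"
  proof -
    have "(\<Sum>n\<in>X. indicator (D n) x *\<^sub>R G x) = (\<Sum>n\<in>X. if n = \<lfloor>x / a\<rfloor> then G x else 0)"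
      using a by (intro sum.cong) (auto simp: D_def indicator_def floor_interval_iff simp del: atLeastLessThan_iff)
    then show ?thesis using that by simp
  qed
  have int: "integrable lborel (\<lambda>x. indicator (D n) x *\<^sub>R G x)"
    if "integrable lborel G" for n and G :: "real \<Rightarrow> 'b::{banach, second_countable_topology}"
    using that by (intro integrable_mult_indicator) (auto simp: D_def)
  have sum: "(\<Sum>n\<in>X. LINT x:D n|lborel. G x) = (LINT x|lborel. (if \<lfloor>x / a\<rfloor> \<in> X then G x else 0))"
    if "integrable lborel G" "finite X" for X and G :: "real \<Rightarrow> 'b::{banach, second_countable_topology}"
    unfolding set_lebesgue_integral_def
    using that by (subst Bochner_Integration.integral_sum[symmetric]) (simp_all only: int ind)
  have "(\<lambda>n. norm (LINT x:D n|lborel. F x)) summable_on UNIV"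
  proof (rule nonneg_bdd_above_summable_on)
    show "bdd_above (sum (\<lambda>n. norm (LINT x:D n|lborel. F x)) ` {X. X \<subseteq> UNIV \<and> finite X})"
    proof (rule bdd_aboveI2)
      fix X assume "X \<in> {X. X \<subseteq> (UNIV::int set) \<and> finite X}"
      then have X: "finite X" by auto
      have "(\<Sum>n\<in>X. norm (LINT x:D n|lborel. F x)) \<le> (\<Sum>n\<in>X. LINT x:D n|lborel. norm (F x))"
        unfolding set_lebesgue_integral_def
        by (intro sum_mono order.trans[OF integral_norm_bound]) simp
      also have "\<dots> = (LINT x|lborel. (if \<lfloor>x / a\<rfloor> \<in> X then norm (F x) else 0))"
        using F X by (intro sum) auto
      also have "\<dots> \<le> (LINT x|lborel. norm (F x))"
        using F by (intro integral_mono') auto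
      finally show "(\<Sum>n\<in>X. norm (LINT x:D n|lborel. F x)) \<le> (LINT x|lborel. norm (F x))" .
    qed
  qed auto
  then have "(\<lambda>n. LINT x:D n|lborel. F x) summable_on UNIV"
    by (rule abs_summable_summable)
  then obtain s where s: "((\<lambda>n. LINT x:D n|lborel. F x) has_sum s) UNIV"
    by (auto simp: summable_on_def)
  have "(\<lambda>k. \<Sum>n\<in>{- int k..int k}. LINT x:D n|lborel. F x) \<longlonglongrightarrow> s"
    using filterlim_compose[OF s[unfolded has_sum_def] filterlim_symmetric_intervals] .
  moreover have "(\<lambda>k. \<Sum>n\<in>{- int k..int k}. LINT x:D n|lborel. F x) \<longlonglongrightarrow> (LINT x|lborel. F x)"
    unfolding sum[OF F finite_atLeastAtMost_int]
  proof (rule integral_dominated_convergence[where w = "\<lambda>x. norm (F x)"])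
    show "AE x in lborel. (\<lambda>k. if \<lfloor>x / a\<rfloor> \<in> {- int k..int k} then F x else 0) \<longlonglongrightarrow> F x"
    proof (rule AE_I2)
      fix x
      have "\<forall>\<^sub>F k in sequentially. (if \<lfloor>x / a\<rfloor> \<in> {- int k..int k} then F x else 0) = F x"
        using eventually_ge_at_top[of "nat \<bar>\<lfloor>x / a\<rfloor>\<bar>"] by eventually_elim auto
      then show "(\<lambda>k. if \<lfloor>x / a\<rfloor> \<in> {- int k..int k} then F x else 0) \<longlonglongrightarrow> F x"
        by (rule tendsto_eventually)
    qed
  qed (use F in auto)
  ultimately have "s = (LINT x|lborel. F x)"
    by (rule LIMSEQ_unique)
  then show ?thesis using s by (simp add: D_def)
qed


section \<open>Trigonometric polynomials\<close>

definition chi :: "real \<Rightarrow> real \<Rightarrow> complex" where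
  "chi s x = cis (2 * pi * (s * x))"

lemma modulation_apply: "modulation s f x = chi s x * f x"
  unfolding modulation_def chi_def cis_conv_exp by (simp add: mult_ac)

lemma norm_chi [simp]: "cmod (chi s x) = 1"
  by (simp add: chi_def)

lemma chi_0 [simp]: "chi 0 x = 1"
  by (simp add: chi_def)

lemma chi_add: "chi (s + t) x = chi s x * chi t x"
  by (simp add: chi_def cis_mult algebra_simps)

lemma chi_diff_arg: "chi s (x - y) = chi s x * cnj (chi s y)"
  by (simp add: chi_def cis_cnj cis_mult algebra_simps)

lemma chi_mult_cnj: "chi s x * cnj (chi t x) = chi (s - t) x"
  by (simp add: chi_def cis_cnj cis_mult algebra_simps)

lemma chi_cnj_same [simp]: "chi s x * cnj (chi s x) = 1"
  by (simp add: chi_mult_cnj)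

lemma continuous_on_chi [continuous_intros]: "continuous_on A (chi s)"
  unfolding chi_def cis_conv_exp by (intro continuous_intros)

lemma measurable_chi [measurable]: "chi s \<in> borel_measurable borel"
  by (intro borel_measurable_continuous_onI continuous_intros)

text \<open>The span of the characters with frequencies in b Z. The inductive form gives closure
  under products by a nested induction, without convolving coefficients; \<open>trig_sum\<close>
  recovers the coefficients at the end.\<close>

inductive_set trig :: "real \<Rightarrow> (real \<Rightarrow> complex) set" for b where
  trig_chi: "chi (of_int m * b) \<in> trig b"
| trig_add: "p \<in> trig b \<Longrightarrow> q \<in> trig b \<Longrightarrow> (\<lambda>x. p x + q x) \<in> trig b"
| trig_scale: "p \<in> trig b \<Longrightarrow> (\<lambda>x. c * p x) \<in> trig b"

lemma trig_const: "(\<lambda>x. c) \<in> trig b"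
  using trig_scale[OF trig_chi[of 0 b], of c] by simp

lemma trig_chi1: "chi b \<in> trig b"
  using trig_chi[of 1 b] by simp

lemma trig_cnj_chi1: "(\<lambda>x. cnj (chi b x)) \<in> trig b"
proof -
  have "(\<lambda>x. cnj (chi b x)) = chi (of_int (-1) * b)"
    by (rule ext) (simp add: chi_def cis_cnj)
  then show ?thesis using trig_chi[of "-1" b] by simp
qed

lemma trig_mult:
  assumes "p \<in> trig b" "q \<in> trig b"
  shows "(\<lambda>x. p x * q x) \<in> trig b"
  using assms
proof (induction p)
  case (trig_chi m)
  from trig_chi.prems show ?case
  proof (induction q)
    case (trig_chi k)
    then show ?case
      using trig.trig_chi[of "m + k" b] by (simp add: distrib_right chi_add[abs_def])
  next
    case (trig_add p q)
    then show ?case by (simp add: distrib_left trig.trig_add)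
  next
    case (trig_scale p c)
    then show ?case using trig.trig_scale[OF trig_scale.IH, of c] by (simp add: mult_ac)
  qed
next
  case (trig_add p q)
  then show ?case by (simp add: distrib_right trig.trig_add)
next
  case (trig_scale p c)
  then show ?case using trig.trig_scale[of "\<lambda>x. p x * q x" b c] by (simp add: mult_ac)
qed

text \<open>A real-linear functional on the plane is a complex combination of z and its conjugate,
  and the conjugate of \<open>chi b\<close> is the character of frequency -b. Sums and products stay
  in \<open>trig b\<close>.\<close>

lemma trig_real_polynomial:
  fixes r :: "complex \<Rightarrow> real"
  assumes "real_polynomial_function r"
  shows "(\<lambda>x. of_real (r (chi b x))) \<in> trig b"
  using assms
proof induction
  case (linear f)
  have f: "f z = Re z * f 1 + Im z * f \<i>" for z
  proof -
    have "f z = f (Re z *\<^sub>R 1 + Im z *\<^sub>R \<i>)"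
      by (rule arg_cong[of _ _ f]) (simp add: complex_eq_iff)
    then show ?thesis
      using linear by (simp add: bounded_linear.linear linear_add linear_scale del: scaleR_complex.simps)
  qed
  have "of_real (f (chi b x)) = (of_real (f 1) / 2 - \<i> * of_real (f \<i>) / 2) * chi b x
           + (of_real (f 1) / 2 + \<i> * of_real (f \<i>) / 2) * cnj (chi b x)" for x
    by (subst f[of "chi b x"]) (simp add: complex_eq_iff field_simps)
  then show ?case by (simp add: trig_add trig_scale trig_chi1 trig_cnj_chi1)
next
  case (const c)
  then show ?case by (simp add: trig_const)
next
  case (add f g)
  then show ?case by (simp add: trig_add)
next
  case (mult f g)
  then show ?case by (simp add: trig_mult)
qed

lemma trig_polynomial:
  fixes g :: "complex \<Rightarrow> complex"
  assumes "polynomial_function g"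
  shows "(\<lambda>x. g (chi b x)) \<in> trig b"
proof -
  have "real_polynomial_function (\<lambda>z. Re (g z))" "real_polynomial_function (\<lambda>z. Im (g z))"
    using assms bounded_linear_Re bounded_linear_Im
    unfolding polynomial_function_def o_def by blast+
  then have "(\<lambda>x. of_real (Re (g (chi b x))) + \<i> * of_real (Im (g (chi b x)))) \<in> trig b"
    by (intro trig_add trig_scale trig_real_polynomial)
  then show ?thesis by (simp flip: complex_eq)
qed

lemma trig_sum:
  assumes "p \<in> trig b"
  obtains F d where "finite F" "\<And>x. p x = (\<Sum>m\<in>F. d m * chi (of_int m * b) x)"
  using assms
proof (induction arbitrary: thesis)
  case (trig_chi m)
  then show ?case by (intro trig_chi[of "{m}" "\<lambda>_. 1"]) auto
next
  case (trig_add p q)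
  obtain F d where F: "finite F" "\<And>x. p x = (\<Sum>m\<in>F. d m * chi (of_int m * b) x)"
    using trig_add.IH(1) by blast
  obtain F' d' where F': "finite F'" "\<And>x. q x = (\<Sum>m\<in>F'. d' m * chi (of_int m * b) x)"
    using trig_add.IH(2) by blast
  define D where "D m = (if m \<in> F then d m else 0) + (if m \<in> F' then d' m else 0)" for m
  have "p x = (\<Sum>m\<in>F \<union> F'. (if m \<in> F then d m else 0) * chi (of_int m * b) x)" for x
    unfolding F(2) by (rule sum.mono_neutral_cong_left) (use F F' in auto)
  moreover have "q x = (\<Sum>m\<in>F \<union> F'. (if m \<in> F' then d' m else 0) * chi (of_int m * b) x)" for x
    unfolding F'(2) by (rule sum.mono_neutral_cong_left) (use F F' in auto)
  ultimately have "p x + q x = (\<Sum>m\<in>F \<union> F'. D m * chi (of_int m * b) x)" for x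
    by (simp add: D_def distrib_right sum.distrib)
  then show ?case using F(1) F'(1) trig_add.prems[of "F \<union> F'" D] by simp
next
  case (trig_scale p c)
  obtain F d where F: "finite F" "\<And>x. p x = (\<Sum>m\<in>F. d m * chi (of_int m * b) x)"
    using trig_scale.IH by blast
  show ?case
    by (rule trig_scale.prems[of F "\<lambda>m. c * d m"]) (use F in \<open>auto simp: sum_distrib_left mult.assoc\<close>)
qed

lemma trig_continuous:
  assumes "p \<in> trig b"
  shows "continuous_on A p"
  using assms
proof induction
  case (trig_chi m)
  show ?case by (rule continuous_on_chi)
next
  case (trig_add p q)
  then show ?case by (intro continuous_on_add)
next
  case (trig_scale p c)
  then show ?case by (intro continuous_on_mult continuous_on_const)
qed

section \<open>Completeness of the trigonometric system\<close>

lemma chi_eq_iff: "chi s x = chi s y \<longleftrightarrow> s * (x - y) \<in> \<int>"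
proof -
  have "chi s x = chi s (x - y) * chi s y" unfolding chi_diff_arg by (simp add: mult.assoc mult.commute)
  moreover have "chi s y \<noteq> 0" using norm_chi[of s y] by force
  ultimately have "chi s x = chi s y \<longleftrightarrow> chi s (x - y) = 1" by simp
  also have "\<dots> \<longleftrightarrow> cos (2 * pi * (s * (x - y))) = 1"
    unfolding chi_def by (auto simp: complex_eq_iff cos_one_sin_zero)
  also have "\<dots> \<longleftrightarrow> (\<exists>n::int. s * (x - y) = of_int n)"
  proof -
    have "2 * pi * t = of_int n * 2 * pi \<longleftrightarrow> t = of_int n" for t and n :: int
      by auto
    then show ?thesis unfolding cos_one_2pi_int by simp
  qed
  finally show ?thesis by (auto simp: Ints_def)
qed

lemma chi_image_interval:
  assumes "L > 0"
  shows "chi (1 / L) ` {c..c + L} = sphere 0 1"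
proof
  show "sphere 0 1 \<subseteq> chi (1 / L) ` {c..c + L}"
  proof
    fix z :: complex assume "z \<in> sphere 0 1"
    then have "cmod z = 1" by simp
    then have z: "z = cis (Arg z)"
      by (subst cis_Arg) (auto simp: sgn_eq)
    define y where "y = Arg z / (2 * pi) * L"
    \<comment> \<open>The point y reduced modulo L into [c, c + L).\<close>
    define x where "x = c + L * frac ((y - c) / L)"
    have y: "chi (1 / L) y = z" using assms z by (simp add: chi_def y_def)
    have "1 / L * (x - y) = of_int (- \<lfloor>(y - c) / L\<rfloor>)"
      using assms by (simp add: x_def frac_def field_simps)
    then have x: "chi (1 / L) x = chi (1 / L) y"
      unfolding chi_eq_iff by (metis Ints_of_int)
    have "x \<in> {c..c + L}"
      using assms frac_ge_0[of "(y - c) / L"] frac_lt_1[of "(y - c) / L"]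
      by (auto simp: x_def mult_le_cancel_left1)
    then show "z \<in> chi (1 / L) ` {c..c + L}" by (rule image_eqI[rotated]) (simp add: x y)
  qed
qed (auto simp: dist_norm)

text \<open>Equal end values let \<phi> factor through the circle. A continuous map from a compact
  space onto a Hausdorff space is a quotient map, so the factor \<Phi> is continuous.
  Stone-Weierstrass on the circle approximates \<Phi> by a real polynomial map in the coordinates,
  which pulls back to a trigonometric polynomial.\<close>

lemma trig_uniform_approx:
  fixes \<phi> :: "real \<Rightarrow> complex"
  assumes L: "L > 0" and cont: "continuous_on {c..c + L} \<phi>" and per: "\<phi> c = \<phi> (c + L)" and e: "e > 0"
  obtains p where "p \<in> trig (1 / L)" "\<And>x. x \<in> {c..c + L} \<Longrightarrow> cmod (\<phi> x - p x) < e"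
proof -
  let ?I = "{c..c + L}"
  define \<Phi> where "\<Phi> z = \<phi> (SOME x. x \<in> ?I \<and> chi (1 / L) x = z)" for z
  have eq: "\<phi> x = \<phi> y" if xy: "x \<in> ?I" "y \<in> ?I" "chi (1 / L) x = chi (1 / L) y" for x y
  proof -
    obtain n :: int where n: "(x - y) / L = of_int n"
      using xy(3) unfolding chi_eq_iff by (auto simp: Ints_def)
    then have xn: "x - y = of_int n * L" using L by (simp add: field_simps)
    have "\<bar>x - y\<bar> \<le> L" using xy(1,2) by auto
    then have "\<bar>real_of_int n\<bar> \<le> 1" using L unfolding xn by (simp add: abs_mult)
    \<comment> \<open>Two points of an interval of length L differ by a multiple of L only if they
      coincide or are its two ends.\<close>
    then have "n = -1 \<or> n = 0 \<or> n = 1" by linarith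
    then consider "x = y" | "x = c" "y = c + L" | "x = c + L" "y = c"
      using xy(1,2) xn by fastforce
    then show ?thesis using per by cases auto
  qed
  have \<Phi>: "\<Phi> (chi (1 / L) x) = \<phi> x" if "x \<in> ?I" for x
    unfolding \<Phi>_def by (rule someI2[of _ x]) (use that eq in blast)+
  have "continuous_map (top_of_set ?I) (top_of_set (sphere 0 1)) (chi (1 / L))"
    using chi_image_interval[OF L, of c] by (auto simp: continuous_map_in_subtopology continuous_on_chi)
  then have "quotient_map (top_of_set ?I) (top_of_set (sphere 0 1)) (chi (1 / L))"
    by (intro continuous_closed_imp_quotient_map continuous_imp_closed_map)
       (use chi_image_interval[OF L, of c] in
         \<open>auto simp: compact_space_subtopology Hausdorff_space_subtopology\<close>)
  moreover have "continuous_map (top_of_set ?I) euclidean (\<Phi> \<circ> chi (1 / L))"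
    using continuous_on_eq[OF cont, of "\<Phi> \<circ> chi (1 / L)"] \<Phi> by simp
  ultimately have "continuous_map (top_of_set (sphere 0 1)) euclidean \<Phi>"
    by (rule continuous_compose_quotient_map)
  then have "continuous_on (sphere 0 1) \<Phi>" by simp
  then obtain g where g: "polynomial_function g" "\<And>z. z \<in> sphere 0 1 \<Longrightarrow> cmod (\<Phi> z - g z) < e"
    using Stone_Weierstrass_polynomial_function[OF compact_sphere _ e] by metis
  show ?thesis
  proof (rule that)
    show "(\<lambda>x. g (chi (1 / L) x)) \<in> trig (1 / L)" by (rule trig_polynomial[OF g(1)])
    show "cmod (\<phi> x - g (chi (1 / L) x)) < e" if "x \<in> ?I" for x
      using g(2)[of "chi (1 / L) x"] \<Phi>[OF that] by (simp add: dist_norm)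
  qed
qed

section \<open>From uniform approximation to approximation in norm\<close>

lemma l2_dominated_convergence:
  assumes f: "f \<in> L2" and W: "W \<in> L2"
    and u: "\<And>n. u n \<in> borel_measurable borel" "\<And>n x. cmod (u n x) \<le> cmod (W x)"
    and lim: "AE x in lborel. (\<lambda>n. u n x) \<longlonglongrightarrow> f x"
  shows "(\<lambda>n. l2_norm (\<lambda>x. f x - u n x)) \<longlonglongrightarrow> 0"
proof -
  note [measurable] = u(1) L2_D(1)[OF f]
  have "(\<lambda>n. LINT x|lborel. (cmod (f x - u n x))\<^sup>2) \<longlonglongrightarrow> integral\<^sup>L lborel (\<lambda>x::real. 0::real)"
  proof (rule integral_dominated_convergence[where f = "\<lambda>x. 0"
        and s = "\<lambda>n x. (cmod (f x - u n x))\<^sup>2" and w = "\<lambda>x. 2 * (cmod (f x))\<^sup>2 + 2 * (cmod (W x))\<^sup>2"])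
    show "integrable lborel (\<lambda>x. 2 * (cmod (f x))\<^sup>2 + 2 * (cmod (W x))\<^sup>2)"
      using L2_D(2)[OF f] L2_D(2)[OF W] by auto
    show "AE x in lborel. (\<lambda>n. (cmod (f x - u n x))\<^sup>2) \<longlonglongrightarrow> 0"
      using lim
    proof eventually_elim
      case (elim x)
      have "(\<lambda>n. (cmod (f x - u n x))\<^sup>2) \<longlonglongrightarrow> (cmod (f x - f x))\<^sup>2"
        by (intro tendsto_intros elim)
      then show ?case by simp
    qed
    show "AE x in lborel. norm ((cmod (f x - u n x))\<^sup>2) \<le> 2 * (cmod (f x))\<^sup>2 + 2 * (cmod (W x))\<^sup>2" for n
    proof (rule AE_I2)
      fix x
      have "cmod (f x - u n x) \<le> cmod (f x) + cmod (W x)"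
        using norm_triangle_ineq4[of "f x" "u n x"] u(2)[of n x] by linarith
      then have "(cmod (f x - u n x))\<^sup>2 \<le> (cmod (f x) + cmod (W x))\<^sup>2"
        by (rule power_mono) simp
      also have "\<dots> \<le> 2 * (cmod (f x))\<^sup>2 + 2 * (cmod (W x))\<^sup>2"
        using sum_squares_bound[of "cmod (f x)" "cmod (W x)"] by (simp add: power2_sum)
      finally show "norm ((cmod (f x - u n x))\<^sup>2) \<le> 2 * (cmod (f x))\<^sup>2 + 2 * (cmod (W x))\<^sup>2" by simp
    qed
  qed measurable
  then have "(\<lambda>n. sqrt (LINT x|lborel. (cmod (f x - u n x))\<^sup>2)) \<longlonglongrightarrow> sqrt 0"
    by (intro tendsto_real_sqrt) simp
  then show ?thesis by (simp add: l2_norm_def)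
qed

lemma L2_bounded_support:
  fixes f :: "real \<Rightarrow> complex"
  assumes [measurable]: "f \<in> borel_measurable borel"
    and "\<And>x. cmod (f x) \<le> M" "\<And>x. x \<notin> {c..d} \<Longrightarrow> f x = 0"
  shows "f \<in> L2"
proof (rule L2_I)
  have "M \<ge> 0" using assms(2)[of 0] norm_ge_zero order_trans by blast
  show "integrable lborel (\<lambda>x. (cmod (f x))\<^sup>2)"
  proof (rule Bochner_Integration.integrable_bound[of _ "\<lambda>x. indicator {c..d} x *\<^sub>R M\<^sup>2"])
    show "integrable lborel (\<lambda>x. indicator {c..d} x *\<^sub>R M\<^sup>2)"
      by (intro integrable_scaleR_left integrable_real_indicator) (auto simp: emeasure_lborel_Icc_eq)
    show "AE x in lborel. norm ((cmod (f x))\<^sup>2) \<le> norm (indicator {c..d} x *\<^sub>R M\<^sup>2)"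
      using assms by (auto simp: indicator_def intro!: power_mono)
  qed measurable
qed fact

text \<open>Lebesgue measurability supplies continuous functions converging to f off a null set. Two
  corrections make them usable: \<open>clip\<close> bounds them uniformly while fixing the values of
  f, and the cutoff \<kappa> makes them vanish outside the open interval. The latter gives equal end
  values, as the passage to the circle requires.\<close>

lemma continuous_approx_bounded:
  fixes f :: "real \<Rightarrow> complex"
  assumes L: "L > 0" and f[measurable]: "f \<in> borel_measurable borel"
    and M: "\<And>x. cmod (f x) \<le> M" and supp: "\<And>x. x \<notin> {c..<c + L} \<Longrightarrow> f x = 0" and e: "e > 0"
  obtains h where "continuous_on UNIV h" "\<And>x. x \<notin> {c<..<c + L} \<Longrightarrow> h x = 0"
    "h \<in> L2" "l2_norm (\<lambda>x. f x - h x) < e"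
proof -
  have M0: "M \<ge> 0" using M[of 0] norm_ge_zero order_trans by blast
  have "f \<in> borel_measurable lebesgue" by (simp add: measurable_completion)
  then have "f measurable_on UNIV" by (simp add: measurable_on_iff_borel_measurable)
  then obtain N g where N: "negligible N" and g: "\<And>n. continuous_on UNIV (g n)"
    and lim: "\<And>x. x \<notin> N \<Longrightarrow> (\<lambda>n. g n x) \<longlonglongrightarrow> f x"
    unfolding measurable_on_def by auto
  \<comment> \<open>A radial retraction onto the disc of radius M + 1; with M alone the denominator
    could be 0.\<close>
  define clip :: "complex \<Rightarrow> complex" where "clip z = ((M + 1) / max (M + 1) (cmod z)) *\<^sub>R z" for z
  have clip_cont: "continuous_on UNIV clip"
    unfolding clip_def using M0 by (intro continuous_intros) (auto simp: max_def)
  have clip_id: "clip z = z" if "cmod z \<le> M" for z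
    using that M0 by (simp add: clip_def max_def)
  have clip_le: "cmod (clip z) \<le> M + 1" for z
  proof (cases "cmod z \<le> M + 1")
    case True
    then show ?thesis using M0 by (simp add: clip_def max_def)
  next
    case False
    then have "cmod z > 0" "M + 1 < cmod z" using M0 by auto
    then show ?thesis using M0 by (simp add: clip_def max_def)
  qed
  define \<kappa> where "\<kappa> n x = min 1 (real n * max 0 (min (x - c) (c + L - x)))" for n x
  have \<kappa>_cont: "continuous_on UNIV (\<kappa> n)" for n
    unfolding \<kappa>_def by (intro continuous_intros)
  have \<kappa>_bound: "0 \<le> \<kappa> n x" "\<kappa> n x \<le> 1" for n x
    unfolding \<kappa>_def by auto
  have \<kappa>_supp: "\<kappa> n x = 0" if "x \<notin> {c<..<c + L}" for n x
    using that L unfolding \<kappa>_def by (auto simp: max_def min_def)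
  have \<kappa>_lim: "(\<lambda>n. \<kappa> n x) \<longlonglongrightarrow> 1" if "x \<in> {c<..<c + L}" for x
  proof (rule tendsto_eventually)
    define d where "d = min (x - c) (c + L - x)"
    have d: "d > 0" using that by (auto simp: d_def)
    show "\<forall>\<^sub>F n in sequentially. \<kappa> n x = 1"
      using eventually_ge_at_top[of "nat \<lceil>1 / d\<rceil>"]
    proof eventually_elim
      case (elim n)
      then have "1 / d \<le> real n" by linarith
      then have "1 \<le> real n * d" using d by (simp add: field_simps)
      then show ?case using d unfolding \<kappa>_def d_def[symmetric] by simp
    qed
  qed
  define u where "u n x = of_real (\<kappa> n x) * clip (g n x)" for n x
  have u_cont: "continuous_on UNIV (u n)" for n
    unfolding u_def
    by (intro continuous_intros \<kappa>_cont continuous_on_compose2[OF clip_cont] g) auto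
  have u_meas: "u n \<in> borel_measurable borel" for n
    by (rule borel_measurable_continuous_onI[OF u_cont])
  have u_supp: "u n x = 0" if "x \<notin> {c<..<c + L}" for n x
    using \<kappa>_supp[OF that] by (simp add: u_def)
  have u_bound: "cmod (u n x) \<le> M + 1" for n x
    using mult_mono[OF \<kappa>_bound(2)[of n x] clip_le[of "g n x"]] \<kappa>_bound(1)[of n x]
    by (simp add: u_def norm_mult)
  define R where "R = M + 1"
  have R0: "R \<ge> 0" using M0 by (simp add: R_def)
  define W :: "real \<Rightarrow> complex" where "W x = (if x \<in> {c..c + L} then of_real R else 0)" for x
  have W: "cmod (W x) = (if x \<in> {c..c + L} then R else 0)" for x
    using R0 by (simp add: W_def)
  have "W \<in> borel_measurable borel" unfolding W_def by measurable
  then have "W \<in> L2"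
    by (rule L2_bounded_support[where c = c and d = "c + L" and M = R])
       (use R0 in \<open>auto simp: W, auto simp: W_def\<close>)
  moreover have "f \<in> L2"
    by (rule L2_bounded_support[where c = c and d = "c + L" and M = M]) (use M supp in auto)
  moreover have "cmod (u n x) \<le> cmod (W x)" for n x
  proof (cases "x \<in> {c..c + L}")
    case True
    then show ?thesis using u_bound[of n x] by (simp add: W R_def)
  next
    case False
    then show ?thesis using u_supp[of x n] R0 by (auto simp: W)
  qed
  moreover have "AE x in lborel. (\<lambda>n. u n x) \<longlonglongrightarrow> f x"
  proof -
    \<comment> \<open>At the left end f may be nonzero while every \<open>u n\<close> vanishes
      there, so c joins the exceptional set.\<close>
    have "negligible (insert c N)" using N by simp
    then have "AE x in lebesgue. x \<notin> insert c N"
      unfolding negligible_iff_null_sets by (rule AE_not_in)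
    then have "AE x in lborel. x \<notin> insert c N"
      by (simp add: AE_completion_iff)
    then show ?thesis
    proof eventually_elim
      case (elim x)
      show ?case
      proof (cases "x \<in> {c<..<c + L}")
        case True
        have "(\<lambda>n. clip (g n x)) \<longlonglongrightarrow> clip (f x)"
          using lim[of x] elim clip_cont
          by (intro isCont_tendsto_compose[of _ clip]) (auto simp: continuous_on_eq_continuous_at)
        then have "(\<lambda>n. u n x) \<longlonglongrightarrow> of_real 1 * clip (f x)"
          unfolding u_def by (intro tendsto_intros \<kappa>_lim True)
        then show ?thesis by (simp add: clip_id M)
      next
        case False
        then show ?thesis using u_supp[OF False] supp[of x] elim by auto
      qed
    qed
  qed
  ultimately have "(\<lambda>n. l2_norm (\<lambda>x. f x - u n x)) \<longlonglongrightarrow> 0"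
    by (intro l2_dominated_convergence u_meas)
  then have "\<forall>\<^sub>F n in sequentially. l2_norm (\<lambda>x. f x - u n x) < e"
    using e by (rule order_tendstoD)
  then obtain n where n: "l2_norm (\<lambda>x. f x - u n x) < e"
    by (auto simp: eventually_sequentially)
  show ?thesis
  proof (rule that[OF u_cont u_supp _ n])
    show "u n \<in> L2"
      by (rule L2_bounded_support[OF u_meas u_bound, where c = c and d = "c + L"])
         (use u_supp in auto)
  qed
qed

text \<open>Three errors of e / 3 each: truncation of large values, replacement by a continuous
  function vanishing at both ends, and uniform approximation by a trigonometric polynomial.\<close>

lemma trig_l2_approx:
  assumes L: "L > 0" and f: "f \<in> L2" and supp: "\<And>x. x \<notin> {c..<c + L} \<Longrightarrow> f x = 0" and e: "e > 0"
  obtains p where "p \<in> trig (1 / L)" "l2_norm (\<lambda>x. f x - indicator {c..<c + L} x * p x) < e"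
proof -
  note [measurable] = L2_D(1)[OF f]
  define v where "v n x = (if cmod (f x) \<le> real n then f x else 0)" for n x
  have v_meas: "v n \<in> borel_measurable borel" for n unfolding v_def by measurable
  have v_le: "cmod (v n x) \<le> cmod (f x)" for n x by (simp add: v_def)
  have "(\<lambda>n. l2_norm (\<lambda>x. f x - v n x)) \<longlonglongrightarrow> 0"
  proof (rule l2_dominated_convergence[OF f f v_meas v_le], rule AE_I2, rule tendsto_eventually)
    fix x show "\<forall>\<^sub>F n in sequentially. v n x = f x"
      using eventually_ge_at_top[of "nat \<lceil>cmod (f x)\<rceil>"]
      by eventually_elim (auto simp: v_def)
  qed
  then have "\<forall>\<^sub>F n in sequentially. l2_norm (\<lambda>x. f x - v n x) < e / 3"
    using e by (intro order_tendstoD) auto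
  then obtain n where n: "l2_norm (\<lambda>x. f x - v n x) < e / 3"
    by (auto simp: eventually_sequentially)
  have vL: "v n \<in> L2" by (rule L2_bound[OF f v_meas v_le])
  obtain h where h: "continuous_on UNIV h" "\<And>x. x \<notin> {c<..<c + L} \<Longrightarrow> h x = 0"
    "h \<in> L2" "l2_norm (\<lambda>x. v n x - h x) < e / 3"
  proof (rule continuous_approx_bounded[OF L v_meas, of n "real n" c "e / 3"])
    show "cmod (v n x) \<le> real n" for x by (simp add: v_def)
    show "v n x = 0" if "x \<notin> {c..<c + L}" for x using supp[OF that] by (simp add: v_def)
  qed (use e in auto)
  \<comment> \<open>The constant 1 on the interval has norm \<open>sqrt L\<close>, so a uniform
    error d costs at most e / 3 in norm.\<close>
  define d where "d = e / (3 * sqrt L)"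
  have "d > 0" using e L by (simp add: d_def)
  moreover have "h c = h (c + L)" using h(2) by simp
  ultimately obtain p where p: "p \<in> trig (1 / L)" "\<And>x. x \<in> {c..c + L} \<Longrightarrow> cmod (h x - p x) < d"
    using trig_uniform_approx[OF L continuous_on_subset[OF h(1)], of c d] by blast
  let ?p = "\<lambda>x. indicator {c..<c + L} x * p x"
  have [measurable]: "p \<in> borel_measurable borel" "h \<in> borel_measurable borel"
    by (intro borel_measurable_continuous_onI trig_continuous[OF p(1)] h(1))+
  have hp: "(\<lambda>x. h x - ?p x) \<in> L2"
  proof (rule L2_bounded_support[where c = c and d = "c + L" and M = d])
    show "cmod (h x - ?p x) \<le> d" for x
      using p(2)[of x] h(2)[of x] \<open>d > 0\<close> by (cases "x \<in> {c..<c + L}") (auto simp: less_imp_le)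
    show "h x - ?p x = 0" if "x \<notin> {c..c + L}" for x using that h(2)[of x] by auto
  qed measurable
  have pL: "?p \<in> L2" using L2_diff[OF h(3) hp] by simp
  have "(LINT x|lborel. (cmod (h x - ?p x))\<^sup>2) \<le> (LINT x|lborel. indicator {c..<c + L} x *\<^sub>R d\<^sup>2)"
  proof (rule integral_mono[OF L2_D(2)[OF hp]])
    show "(cmod (h x - ?p x))\<^sup>2 \<le> indicator {c..<c + L} x *\<^sub>R d\<^sup>2" for x
      using p(2)[of x] h(2)[of x] by (cases "x \<in> {c..<c + L}") (auto intro!: power_mono simp: less_imp_le)
  qed (intro integrable_scaleR_left integrable_real_indicator, use L in auto)
  also have "\<dots> = (e / 3)\<^sup>2"
    using L by (simp add: d_def power_divide power_mult_distrib)
  finally have "l2_norm (\<lambda>x. h x - ?p x) \<le> e / 3"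
    unfolding l2_norm_sq[symmetric] by (rule power2_le_imp_le) (use e in simp)
  then have "l2_norm (\<lambda>x. f x - ?p x) < e"
    using l2_norm_triangle3[OF f vL pL] l2_norm_triangle3[OF vL h(3) pL] n h(4) by linarith
  then show ?thesis using that p(1) by blast
qed


section \<open>Parseval's identity on an interval\<close>

lemma integral_chi_interval:
  fixes k :: int
  assumes b: "b > 0"
  shows "(LINT x|lborel. indicator {c..<c + 1 / b} x *\<^sub>R chi (of_int k * b) x)
    = (if k = 0 then of_real (1 / b) else 0)"
proof (cases "k = 0")
  case True
  have "(LINT x|lborel. indicator {c..<c + 1 / b} x *\<^sub>R (1::complex))
      = measure lborel {c..<c + 1 / b} *\<^sub>R 1"
    by (subst integral_scaleR_left) (use b in auto)
  then show ?thesis using True b by (simp add: scaleR_conv_of_real)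
next
  case False
  define s where "s = of_int k * b"
  define w where "w = 2 * of_real pi * \<i> * of_real s"
  have s: "s \<noteq> 0" using False b by (simp add: s_def)
  have w: "w \<noteq> 0" using s by (simp add: w_def)
  have exp: "chi s x = exp (w * of_real x)" for x
    by (simp add: chi_def cis_conv_exp w_def mult_ac)
  have "(LINT x|lborel. indicator {c..<c + 1 / b} x *\<^sub>R chi s x)
      = (LINT x|lborel. indicator {c..c + 1 / b} x *\<^sub>R chi s x)"
  proof (rule integral_cong_AE)
    show "AE x in lborel. indicator {c..<c + 1 / b} x *\<^sub>R chi s x = indicator {c..c + 1 / b} x *\<^sub>R chi s x"
      using AE_lborel_singleton[of "c + 1 / b"] by eventually_elim (auto simp: indicator_def)
  qed measurable
  also have "\<dots> = exp (w * of_real (c + 1 / b)) / w - exp (w * of_real c) / w"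
  proof (rule integral_FTC_atLeastAtMost)
    show "((\<lambda>x. exp (w * of_real x) / w) has_vector_derivative chi s x) (at x within {c..c + 1 / b})" for x
      unfolding exp by (rule has_vector_derivative_real_field) (use w in \<open>auto intro!: derivative_eq_intros\<close>)
  qed (use b continuous_on_chi in auto)
  also have "\<dots> = (chi s (c + 1 / b) - chi s c) / w"
    by (simp add: exp diff_divide_distrib)
  \<comment> \<open>The quotient s / b is the integer k, so the interval holds whole periods and the
    boundary terms agree.\<close>
  also have "chi s (c + 1 / b) = chi s c"
    unfolding chi_eq_iff using b by (simp add: s_def)
  finally show ?thesis using False by (simp add: s_def)
qed

text \<open>Up to the factor \<open>sqrt b\<close>, the Fourier basis of an interval of length 1/b.
  It is left unnormalised because the Gabor elements of a rectangular window of that length are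
  exactly these functions.\<close>

definition window_tone :: "real \<Rightarrow> real \<Rightarrow> int \<Rightarrow> real \<Rightarrow> complex" where
  "window_tone b c m x = indicator {c..<c + 1 / b} x * chi (of_int m * b) x"

lemma window_tone_L2: "b > 0 \<Longrightarrow> window_tone b c m \<in> L2"
proof (rule L2_bounded_support[where c = c and d = "c + 1 / b" and M = 1])
  show "window_tone b c m \<in> borel_measurable borel"
    unfolding window_tone_def[abs_def] by measurable
qed (auto simp: window_tone_def norm_mult indicator_def)

lemma window_tone_inner:
  assumes "b > 0"
  shows "l2_inner (window_tone b c m) (window_tone b c k) = (if m = k then of_real (1 / b) else 0)"
proof -
  have "window_tone b c m x * cnj (window_tone b c k x)
      = indicator {c..<c + 1 / b} x *\<^sub>R chi (of_int (m - k) * b) x" for x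
    by (simp add: window_tone_def indicator_def chi_mult_cnj left_diff_distrib)
  then have "l2_inner (window_tone b c m) (window_tone b c k)
      = (LINT x|lborel. indicator {c..<c + 1 / b} x *\<^sub>R chi (of_int (m - k) * b) x)"
    by (simp add: l2_inner_def)
  then show ?thesis using integral_chi_interval[OF assms, of c "m - k"] by simp
qed

text \<open>One formula for the squared error serves both halves of Parseval: the optimal
  coefficients give the upper bound, and the coefficients of an arbitrarily good approximation give
  the lower one.\<close>

lemma window_tone_combination:
  fixes d :: "int \<Rightarrow> complex"
  assumes b: "b > 0" and f: "f \<in> L2" and F: "finite F"
  shows "(l2_norm (\<lambda>x. f x - (\<Sum>m\<in>F. d m * window_tone b c m x)))\<^sup>2
    = (l2_norm f)\<^sup>2 - (\<Sum>m\<in>F. 2 * Re (cnj (d m) * l2_inner f (window_tone b c m)) - (cmod (d m))\<^sup>2 / b)"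
proof -
  let ?p = "\<lambda>x. \<Sum>m\<in>F. d m * window_tone b c m x"
  have T: "(\<lambda>x. d m * window_tone b c m x) \<in> L2" for m
    by (intro L2_scale window_tone_L2 b)
  have p: "?p \<in> L2" by (intro L2_sum T)
  have "l2_inner ?p ?p = (\<Sum>m\<in>F. \<Sum>k\<in>F. d m * (cnj (d k) * (if m = k then of_real (1 / b) else 0)))"
    by (subst l2_inner_sum_left[OF T p], subst l2_inner_sum_right[OF T T])
       (simp add: l2_inner_scale_left l2_inner_scale_right window_tone_inner[OF b] sum_distrib_left mult.left_commute)
  also have "\<dots> = (\<Sum>m\<in>F. of_real ((cmod (d m))\<^sup>2 / b))"
    using F by (intro sum.cong refl)
      (simp add: if_distrib[of "\<lambda>x. _ * x"] complex_norm_square[symmetric] mult.assoc[symmetric]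
        flip: of_real_power cong: if_cong)
  finally have "(l2_norm ?p)\<^sup>2 = (\<Sum>m\<in>F. (cmod (d m))\<^sup>2 / b)"
    unfolding Re_l2_inner_self[symmetric] by simp
  moreover have "l2_inner f ?p = (\<Sum>m\<in>F. cnj (d m) * l2_inner f (window_tone b c m))"
    by (subst l2_inner_sum_right[OF T f]) (simp add: l2_inner_scale_right)
  ultimately show ?thesis
    by (subst l2_norm_diff_sq[OF f p]) (simp add: sum_subtractf sum_distrib_left)
qed

lemma window_tone_approx:
  assumes b: "b > 0" and f: "f \<in> L2" and supp: "\<And>x. x \<notin> {c..<c + 1 / b} \<Longrightarrow> f x = 0" and e: "e > 0"
  obtains F d where "finite F" "l2_norm (\<lambda>x. f x - (\<Sum>m\<in>F. d m * window_tone b c m x)) < e"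
proof -
  obtain p where p: "p \<in> trig b" "l2_norm (\<lambda>x. f x - indicator {c..<c + 1 / b} x * p x) < e"
    using trig_l2_approx[of "1 / b" f c e] assms by auto
  obtain F d where F: "finite F" "\<And>x. p x = (\<Sum>m\<in>F. d m * chi (of_int m * b) x)"
    using trig_sum[OF p(1)] by blast
  have "indicator {c..<c + 1 / b} x * p x = (\<Sum>m\<in>F. d m * window_tone b c m x)" for x
    unfolding F(2) sum_distrib_left window_tone_def by (simp add: mult.left_commute)
  then show ?thesis using that[OF F(1), of d] p(2) by simp
qed

lemma parseval_interval:
  assumes b: "b > 0" and f: "f \<in> L2" and supp: "\<And>x. x \<notin> {c..<c + 1 / b} \<Longrightarrow> f x = 0"
  shows "((\<lambda>m. (cmod (l2_inner f (window_tone b c m)))\<^sup>2) has_sum (l2_norm f)\<^sup>2 / b) UNIV"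
proof -
  define C where "C m = l2_inner f (window_tone b c m)" for m
  have upper: "(\<Sum>m\<in>F. (cmod (C m))\<^sup>2) \<le> (l2_norm f)\<^sup>2 / b" if F: "finite F" for F
  proof -
    \<comment> \<open>The orthogonal projection has coefficients b C m, since each tone has squared
      norm 1/b.\<close>
    have "2 * Re (cnj (of_real b * C m) * C m) - (cmod (of_real b * C m))\<^sup>2 / b = b * (cmod (C m))\<^sup>2" for m
    proof -
      have "Re (cnj (of_real b * C m) * C m) = b * (cmod (C m))\<^sup>2"
        unfolding cmod_power2 by (simp add: power2_eq_square algebra_simps)
      then show ?thesis using b by (simp add: norm_mult power2_eq_square)
    qed
    then have "0 \<le> (l2_norm f)\<^sup>2 - (\<Sum>m\<in>F. b * (cmod (C m))\<^sup>2)"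
      using window_tone_combination[OF b f F, of "\<lambda>m. of_real b * C m" c] unfolding C_def
      by (metis (no_types, lifting) sum.cong zero_le_power2)
    then show ?thesis using b by (simp add: sum_distrib_left[symmetric] field_simps)
  qed
  have "(\<lambda>m. (cmod (C m))\<^sup>2) summable_on UNIV"
    by (intro nonneg_bdd_above_summable_on bdd_aboveI2[where M = "(l2_norm f)\<^sup>2 / b"]) (auto intro: upper)
  then obtain s where s: "((\<lambda>m. (cmod (C m))\<^sup>2) has_sum s) UNIV"
    by (auto simp: summable_on_def)
  have "s \<le> (l2_norm f)\<^sup>2 / b"
    using s by (rule has_sum_le_finite_sums) (rule upper)
  moreover have "(l2_norm f)\<^sup>2 / b \<le> s"
  proof (rule field_le_epsilon)
    fix e :: real assume e: "e > 0"
    obtain F d where F: "finite F"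
      and d: "l2_norm (\<lambda>x. f x - (\<Sum>m\<in>F. d m * window_tone b c m x)) < sqrt (e * b)"
    proof (rule window_tone_approx[OF b f supp])
      show "sqrt (e * b) > 0" using e b by simp
    qed
    \<comment> \<open>Completing the square: no coefficient reduces the error by more than the
      optimal one does.\<close>
    have "2 * Re (cnj (d m) * C m) - (cmod (d m))\<^sup>2 / b \<le> b * (cmod (C m))\<^sup>2" for m
    proof -
      have "Re (cnj (d m) * C m) \<le> cmod (d m) * cmod (C m)"
        using complex_Re_le_cmod[of "cnj (d m) * C m"] by (simp add: norm_mult)
      moreover have "0 \<le> (cmod (d m) - b * cmod (C m))\<^sup>2 / b" using b by simp
      moreover have "(cmod (d m) - b * cmod (C m))\<^sup>2 / b
          = (cmod (d m))\<^sup>2 / b - 2 * (cmod (d m) * cmod (C m)) + b * (cmod (C m))\<^sup>2"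
        using b by (simp add: power2_diff field_simps power2_eq_square)
      ultimately show ?thesis by linarith
    qed
    then have "(\<Sum>m\<in>F. 2 * Re (cnj (d m) * C m) - (cmod (d m))\<^sup>2 / b) \<le> b * (\<Sum>m\<in>F. (cmod (C m))\<^sup>2)"
      unfolding sum_distrib_left by (intro sum_mono)
    then have "(l2_norm f)\<^sup>2 - b * (\<Sum>m\<in>F. (cmod (C m))\<^sup>2)
        \<le> (l2_norm (\<lambda>x. f x - (\<Sum>m\<in>F. d m * window_tone b c m x)))\<^sup>2"
      unfolding window_tone_combination[OF b f F] C_def by simp
    also have "\<dots> \<le> (sqrt (e * b))\<^sup>2" using d by (intro power_mono) auto
    also have "\<dots> = e * b" using e b by simp
    finally have "(l2_norm f)\<^sup>2 \<le> e * b + b * (\<Sum>m\<in>F. (cmod (C m))\<^sup>2)" by simp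
    also have "\<dots> \<le> e * b + b * s"
      using b by (intro add_left_mono mult_left_mono finite_sum_le_has_sum[OF s F]) auto
    finally show "(l2_norm f)\<^sup>2 / b \<le> s + e" using b by (simp add: field_simps)
  qed
  ultimately show ?thesis using s by (simp add: C_def)
qed

text \<open>Polarisation. With u running through 1, -1, \<i>, -\<i>, the weighted squares u |z + u
  w|^2 add up to 4 z times the conjugate of w; the identity is applied both to the coefficients and
  to the norms.\<close>

lemma parseval_interval_inner:
  assumes b: "b > 0" and f: "f \<in> L2" "\<And>x. x \<notin> {c..<c + 1 / b} \<Longrightarrow> f x = 0"
    and h: "h \<in> L2" "\<And>x. x \<notin> {c..<c + 1 / b} \<Longrightarrow> h x = 0"
  shows "((\<lambda>m. l2_inner f (window_tone b c m) * cnj (l2_inner h (window_tone b c m)))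
           has_sum l2_inner f h / of_real b) UNIV"
proof -
  define \<alpha> where "\<alpha> m = l2_inner f (window_tone b c m)" for m
  define \<beta> where "\<beta> m = l2_inner h (window_tone b c m)" for m
  define Q where "Q u m = u * of_real ((cmod (\<alpha> m + u * \<beta> m))\<^sup>2)" for u :: complex and m
  define R where "R u = u * of_real ((l2_norm (\<lambda>x. f x + u * h x))\<^sup>2 / b)" for u :: complex
  have Q: "(Q u has_sum R u) UNIV" for u
  proof -
    have uh: "(\<lambda>x. u * h x) \<in> L2" by (intro L2_scale h)
    have "((\<lambda>m. (cmod (l2_inner (\<lambda>x. f x + u * h x) (window_tone b c m)))\<^sup>2)
       has_sum (l2_norm (\<lambda>x. f x + u * h x))\<^sup>2 / b) UNIV"
      by (intro parseval_interval b L2_add f uh) (simp add: f h)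
    then have "((\<lambda>m. (cmod (\<alpha> m + u * \<beta> m))\<^sup>2)
       has_sum (l2_norm (\<lambda>x. f x + u * h x))\<^sup>2 / b) UNIV"
      by (simp add: l2_inner_add_left[OF f(1) uh window_tone_L2[OF b]] l2_inner_scale_left \<alpha>_def \<beta>_def)
    then show ?thesis
      unfolding Q_def R_def by (intro has_sum_cmult_right has_sum_of_real)
  qed
  have pol: "z * cnj w = (1 * of_real ((cmod (z + 1 * w))\<^sup>2) + (-1) * of_real ((cmod (z + (-1) * w))\<^sup>2)
      + \<i> * of_real ((cmod (z + \<i> * w))\<^sup>2) + (-\<i>) * of_real ((cmod (z + (-\<i>) * w))\<^sup>2)) * (1 / 4)" for z w
    unfolding cmod_power2 by (simp add: complex_eq_iff power2_eq_square algebra_simps)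
  have "((\<lambda>m. (Q 1 m + Q (-1) m + Q \<i> m + Q (-\<i>) m) * (1 / 4))
      has_sum (R 1 + R (-1) + R \<i> + R (-\<i>)) * (1 / 4)) UNIV"
    by (intro has_sum_cmult_left has_sum_add Q)
  also have "(\<lambda>m. (Q 1 m + Q (-1) m + Q \<i> m + Q (-\<i>) m) * (1 / 4)) = (\<lambda>m. \<alpha> m * cnj (\<beta> m))"
    unfolding pol Q_def ..
  also have "(R 1 + R (-1) + R \<i> + R (-\<i>)) * (1 / 4) = l2_inner f h / of_real b"
  proof -
    have N: "R u = (u * (l2_inner f f + cnj u * l2_inner f h + u * (l2_inner h f + cnj u * l2_inner h h))) / of_real b" for u
    proof -
      have uh: "(\<lambda>x. u * h x) \<in> L2" by (intro L2_scale h)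
      have "R u = u * l2_inner (\<lambda>x. f x + u * h x) (\<lambda>x. f x + u * h x) / of_real b"
        unfolding R_def l2_inner_self by simp
      then show ?thesis
        by (simp add: l2_inner_add_left[OF f(1) uh L2_add[OF f(1) uh]] l2_inner_add_right[OF f(1) uh f(1)]
            l2_inner_add_right[OF f(1) uh h(1)] l2_inner_scale_left l2_inner_scale_right add.assoc)
    qed
    have pol': "1 * (p + cnj 1 * q + 1 * (r + cnj 1 * s)) + (-1) * (p + cnj (-1) * q + (-1) * (r + cnj (-1) * s))
        + \<i> * (p + cnj \<i> * q + \<i> * (r + cnj \<i> * s))
        + (-\<i>) * (p + cnj (-\<i>) * q + (-\<i>) * (r + cnj (-\<i>) * s)) = 4 * q" for p q r s
      by (simp add: algebra_simps)
    show ?thesis unfolding N add_divide_distrib[symmetric] pol' by simp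
  qed
  finally show ?thesis unfolding \<alpha>_def \<beta>_def .
qed

section \<open>Completeness of the space of square integrable functions\<close>

lemma L2_nn_integral:
  assumes "f \<in> L2"
  shows "(\<integral>\<^sup>+x. ennreal ((cmod (f x))\<^sup>2) \<partial>lborel) = ennreal ((l2_norm f)\<^sup>2)"
  unfolding l2_norm_sq by (rule nn_integral_eq_integral) (use L2_D(2)[OF assms] in auto)

text \<open>The weights 2^n still leave a summable total integral 2^-n, so the weighted sum of |d
  n|^2 is finite almost everywhere. The bound |d n| \<le> 2^n |d n|^2 + 2^-n then gives absolute
  convergence at such points, although square integrability does not control the L1 norm on the
  whole line.\<close>

lemma L2_fast_Cauchy_AE_convergent:
  assumes u: "\<And>n. u n \<in> L2" and fast: "\<And>n. l2_norm (\<lambda>x. u (Suc n) x - u n x) \<le> (1/2) ^ n"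
  shows "AE x in lborel. convergent (\<lambda>n. u n x)"
proof -
  note [measurable] = L2_D(1)[OF u]
  define d where "d n x = u (Suc n) x - u n x" for n x
  have d: "d n \<in> L2" for n unfolding d_def[abs_def] by (intro L2_diff u)
  note [measurable] = L2_D(1)[OF d]
  have "(\<integral>\<^sup>+x. (\<Sum>n. ennreal (2 ^ n * (cmod (d n x))\<^sup>2)) \<partial>lborel)
      = (\<Sum>n. \<integral>\<^sup>+x. ennreal (2 ^ n * (cmod (d n x))\<^sup>2) \<partial>lborel)"
    by (rule nn_integral_suminf) measurable
  also have "\<dots> \<le> (\<Sum>n. ennreal ((1/2) ^ n))"
  proof (rule suminf_le)
    fix n
    have "(\<integral>\<^sup>+x. ennreal (2 ^ n * (cmod (d n x))\<^sup>2) \<partial>lborel)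
        = ennreal (2 ^ n) * (\<integral>\<^sup>+x. ennreal ((cmod (d n x))\<^sup>2) \<partial>lborel)"
      by (subst nn_integral_cmult[symmetric]) (auto simp: ennreal_mult)
    also have "\<dots> = ennreal (2 ^ n * (l2_norm (d n))\<^sup>2)"
      by (simp add: L2_nn_integral[OF d] ennreal_mult)
    also have "\<dots> \<le> ennreal ((1/2) ^ n)"
    proof (rule ennreal_leI)
      have "(l2_norm (d n))\<^sup>2 \<le> ((1/2) ^ n)\<^sup>2"
        using fast[of n] unfolding d_def by (intro power_mono) auto
      then have "2 ^ n * (l2_norm (d n))\<^sup>2 \<le> 2 ^ n * ((1/2) ^ n * (1/2) ^ n)"
        by (simp add: power2_eq_square)
      also have "\<dots> = (1/2) ^ n" by (simp add: power_divide)
      finally show "2 ^ n * (l2_norm (d n))\<^sup>2 \<le> (1/2) ^ n" .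
    qed
    finally show "(\<integral>\<^sup>+x. ennreal (2 ^ n * (cmod (d n x))\<^sup>2) \<partial>lborel) \<le> ennreal ((1/2) ^ n)" .
  qed auto
  also have "\<dots> = ennreal (\<Sum>n. (1/2) ^ n)"
    by (intro suminf_ennreal2 summable_geometric) auto
  finally have "(\<integral>\<^sup>+x. (\<Sum>n. ennreal (2 ^ n * (cmod (d n x))\<^sup>2)) \<partial>lborel) \<noteq> \<infinity>"
    by (metis ennreal_less_top infinity_ennreal_def linorder_not_le)
  then have "AE x in lborel. (\<Sum>n. ennreal (2 ^ n * (cmod (d n x))\<^sup>2)) \<noteq> \<infinity>"
    by (intro nn_integral_PInf_AE) measurable
  then show ?thesis
  proof eventually_elim
    case (elim x)
    then have "summable (\<lambda>n. 2 ^ n * (cmod (d n x))\<^sup>2)"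
      by (intro summable_suminf_not_top) auto
    moreover have "summable (\<lambda>n. (1/2::real) ^ n)" by (simp add: summable_geometric)
    ultimately have "summable (\<lambda>n. 2 ^ n * (cmod (d n x))\<^sup>2 + (1/2) ^ n)" by (rule summable_add)
    then have "summable (\<lambda>n. d n x)"
    proof (rule summable_comparison_test'[where N = 0])
      fix n :: nat
      have "0 \<le> (2 ^ n * cmod (d n x) - 1)\<^sup>2" by simp
      then have "2 * (2 ^ n * cmod (d n x)) \<le> (2 ^ n * cmod (d n x))\<^sup>2 + 1"
        by (simp add: power2_diff)
      moreover have "2 ^ n * cmod (d n x) \<le> 2 * (2 ^ n * cmod (d n x))" by simp
      ultimately have "2 ^ n * cmod (d n x) \<le> (2 ^ n * cmod (d n x))\<^sup>2 + 1" by linarith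
      also have "\<dots> = 2 ^ n * (2 ^ n * (cmod (d n x))\<^sup>2 + (1/2) ^ n)"
        by (simp add: power2_eq_square distrib_left power_one_over mult_ac)
      finally show "norm (d n x) \<le> 2 ^ n * (cmod (d n x))\<^sup>2 + (1/2) ^ n" by simp
    qed
    then have "(\<lambda>n. \<Sum>k<n. d k x) \<longlonglongrightarrow> (\<Sum>k. d k x)"
      by (rule summable_LIMSEQ)
    then have "(\<lambda>n. u 0 x + (\<Sum>k<n. d k x)) \<longlonglongrightarrow> u 0 x + (\<Sum>k. d k x)"
      by (intro tendsto_intros)
    moreover have "u 0 x + (\<Sum>k<n. d k x) = u n x" for n
      unfolding d_def by (subst sum_lessThan_telescope) simp
    ultimately show ?case by (auto simp: convergent_def)
  qed
qed

text \<open>Riesz-Fischer. A fast subsequence converges almost everywhere, and Fatou along it bounds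
  the distance of the limit from every late term of the full sequence, not only from the
  subsequence.\<close>

lemma L2_complete:
  assumes u: "\<And>n. u n \<in> L2"
    and Cauchy: "\<And>e. e > 0 \<Longrightarrow> \<exists>N. \<forall>m\<ge>N. \<forall>n\<ge>N. l2_norm (\<lambda>x. u m x - u n x) < e"
  obtains f where "f \<in> L2" "(\<lambda>n. l2_norm (\<lambda>x. f x - u n x)) \<longlonglongrightarrow> 0"
proof -
  note [measurable] = L2_D(1)[OF u]
  obtain N where N: "\<And>k m n. m \<ge> N k \<Longrightarrow> n \<ge> N k \<Longrightarrow> l2_norm (\<lambda>x. u m x - u n x) < (1/2) ^ k"
    using Cauchy[of "(1/2) ^ k" for k] by (simp, metis)
  \<comment> \<open>Partial sums of N are monotone in k and dominate \<open>N j\<close> for all j up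
    to k.\<close>
  define r where "r k = (\<Sum>j\<le>k. N j)" for k
  have rN: "N k \<le> r j" if "k \<le> j" for k j
    unfolding r_def using that by (intro member_le_sum) auto
  have AE: "AE x in lborel. convergent (\<lambda>k. u (r k) x)"
  proof (rule L2_fast_Cauchy_AE_convergent[OF u])
    show "l2_norm (\<lambda>x. u (r (Suc k)) x - u (r k) x) \<le> (1/2) ^ k" for k
      using N[OF rN rN, of k "Suc k" k] by simp
  qed
  \<comment> \<open>On the null set where the subsequence diverges, \<open>lim\<close> has an
    unspecified value.\<close>
  define f where "f x = lim (\<lambda>k. u (r k) x)" for x
  have f_meas[measurable]: "f \<in> borel_measurable borel"
    unfolding f_def[abs_def] by measurable
  have fatou: "(\<integral>\<^sup>+x. ennreal ((cmod (f x - u n x))\<^sup>2) \<partial>lborel) \<le> ennreal (((1/2) ^ j)\<^sup>2)"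
    if n: "n \<ge> N j" for n j
  proof -
    have "(\<integral>\<^sup>+x. ennreal ((cmod (f x - u n x))\<^sup>2) \<partial>lborel)
        = (\<integral>\<^sup>+x. liminf (\<lambda>k. ennreal ((cmod (u (r k) x - u n x))\<^sup>2)) \<partial>lborel)"
    proof (rule nn_integral_cong_AE)
      show "AE x in lborel. ennreal ((cmod (f x - u n x))\<^sup>2)
          = liminf (\<lambda>k. ennreal ((cmod (u (r k) x - u n x))\<^sup>2))"
        using AE
      proof eventually_elim
        case (elim x)
        then have "(\<lambda>k. u (r k) x) \<longlonglongrightarrow> f x"
          unfolding f_def by (simp add: convergent_LIMSEQ_iff)
        then have "(\<lambda>k. ennreal ((cmod (u (r k) x - u n x))\<^sup>2)) \<longlonglongrightarrow> ennreal ((cmod (f x - u n x))\<^sup>2)"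
          by (intro tendsto_ennrealI tendsto_intros)
        then show ?case by (intro lim_imp_Liminf[symmetric]) auto
      qed
    qed
    also have "\<dots> \<le> liminf (\<lambda>k. \<integral>\<^sup>+x. ennreal ((cmod (u (r k) x - u n x))\<^sup>2) \<partial>lborel)"
      by (rule nn_integral_liminf) measurable
    also have "\<dots> \<le> ennreal (((1/2) ^ j)\<^sup>2)"
    proof (rule Liminf_le)
      show "\<forall>\<^sub>F k in sequentially.
          (\<integral>\<^sup>+x. ennreal ((cmod (u (r k) x - u n x))\<^sup>2) \<partial>lborel) \<le> ennreal (((1/2) ^ j)\<^sup>2)"
        using eventually_ge_at_top[of j]
      proof eventually_elim
        case (elim k)
        have "(\<integral>\<^sup>+x. ennreal ((cmod (u (r k) x - u n x))\<^sup>2) \<partial>lborel)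
            = ennreal ((l2_norm (\<lambda>x. u (r k) x - u n x))\<^sup>2)"
          by (intro L2_nn_integral L2_diff u)
        also have "\<dots> \<le> ennreal (((1/2) ^ j)\<^sup>2)"
          using N[OF rN[OF elim] n] by (intro ennreal_leI power_mono) auto
        finally show ?case .
      qed
    qed simp
    finally show ?thesis .
  qed
  have diff: "(\<lambda>x. f x - u n x) \<in> L2" if "n \<ge> N j" for n j
  proof (rule L2_I)
    show "integrable lborel (\<lambda>x. (cmod (f x - u n x))\<^sup>2)"
      by (rule integrableI_nonneg) (use le_less_trans[OF fatou[OF that]] in auto)
  qed measurable
  have bound: "l2_norm (\<lambda>x. f x - u n x) \<le> (1/2) ^ j" if "n \<ge> N j" for n j
  proof (rule power2_le_imp_le)
    show "(l2_norm (\<lambda>x. f x - u n x))\<^sup>2 \<le> ((1/2) ^ j)\<^sup>2"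
      using fatou[OF that] unfolding L2_nn_integral[OF diff[OF that]] by (simp del: power_divide)
  qed simp
  show ?thesis
  proof (rule that)
    show "f \<in> L2" using L2_add[OF diff[of 0 "N 0"] u[of "N 0"]] by simp
    show "(\<lambda>n. l2_norm (\<lambda>x. f x - u n x)) \<longlonglongrightarrow> 0"
    proof (rule LIMSEQ_I)
      fix e :: real assume "e > 0"
      then obtain j where j: "(1/2) ^ j < e" using real_arch_pow_inv[of e "1/2"] by auto
      show "\<exists>no. \<forall>n\<ge>no. norm (l2_norm (\<lambda>x. f x - u n x) - 0) < e"
        using bound[of j] j by (intro exI[of _ "N j"]) force
    qed
  qed
qed


section \<open>Bessel sequences\<close>

lemma weighted_am_gm:
  fixes x y B :: real
  assumes "B > 0"
  shows "x * y \<le> (B * x\<^sup>2 + y\<^sup>2 / B) / 2"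
proof -
  have "0 \<le> (B * x - y)\<^sup>2 / B" using assms by simp
  also have "\<dots> = B * x\<^sup>2 - 2 * (x * y) + y\<^sup>2 / B"
    using assms by (simp add: power2_diff field_simps power2_eq_square)
  finally show ?thesis by simp
qed

text \<open>Only an upper bound is assumed: thinning a frame keeps it, whereas the lower frame bound
  may be lost.\<close>

locale bessel =
  fixes \<phi> :: "int \<times> int \<Rightarrow> real \<Rightarrow> complex" and B :: real
  assumes \<phi>: "\<And>i. \<phi> i \<in> L2" and B: "B > 0"
    and summable: "\<And>f. f \<in> L2 \<Longrightarrow> (\<lambda>i. (cmod (l2_inner f (\<phi> i)))\<^sup>2) summable_on UNIV"
    and bound: "\<And>f. f \<in> L2 \<Longrightarrow> (\<Sum>\<^sub>\<infinity>i. (cmod (l2_inner f (\<phi> i)))\<^sup>2) \<le> B * (l2_norm f)\<^sup>2"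
begin

lemma finite_bound:
  assumes "f \<in> L2" "finite X"
  shows "(\<Sum>i\<in>X. (cmod (l2_inner f (\<phi> i)))\<^sup>2) \<le> B * (l2_norm f)\<^sup>2"
proof -
  have "(\<Sum>i\<in>X. (cmod (l2_inner f (\<phi> i)))\<^sup>2) \<le> (\<Sum>\<^sub>\<infinity>i. (cmod (l2_inner f (\<phi> i)))\<^sup>2)"
    using assms by (intro finite_sum_le_infsum summable) auto
  then show ?thesis using bound[OF assms(1)] by simp
qed

text \<open>The dual form of the Bessel inequality. The weight B in the arithmetic-geometric mean is
  chosen so that the coefficients of p contribute half of its squared norm, which the left-hand side
  absorbs.\<close>

lemma synthesis_bound:
  fixes c :: "int \<times> int \<Rightarrow> complex"
  assumes X: "finite X"
  shows "(l2_norm (\<lambda>x. \<Sum>i\<in>X. c i * \<phi> i x))\<^sup>2 \<le> B * (\<Sum>i\<in>X. (cmod (c i))\<^sup>2)"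
proof -
  define p where "p = (\<lambda>x. \<Sum>i\<in>X. c i * \<phi> i x)"
  have p: "p \<in> L2" unfolding p_def by (intro L2_sum L2_scale \<phi>)
  have "l2_inner p p = (\<Sum>i\<in>X. c i * l2_inner (\<phi> i) p)"
    by (subst (1) p_def, subst l2_inner_sum_left) (auto simp: l2_inner_scale_left intro: p L2_scale \<phi>)
  then have "(l2_norm p)\<^sup>2 = Re (\<Sum>i\<in>X. c i * l2_inner (\<phi> i) p)"
    by (simp flip: Re_l2_inner_self)
  also have "\<dots> \<le> (\<Sum>i\<in>X. (B * (cmod (c i))\<^sup>2 + (cmod (l2_inner p (\<phi> i)))\<^sup>2 / B) / 2)"
    unfolding Re_sum
  proof (rule sum_mono)
    fix i
    have "Re (c i * l2_inner (\<phi> i) p) \<le> cmod (c i) * cmod (l2_inner p (\<phi> i))"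
      using complex_Re_le_cmod[of "c i * l2_inner (\<phi> i) p"] l2_inner_commute[of p "\<phi> i"]
      by (simp add: norm_mult)
    also have "\<dots> \<le> (B * (cmod (c i))\<^sup>2 + (cmod (l2_inner p (\<phi> i)))\<^sup>2 / B) / 2"
      by (rule weighted_am_gm[OF B])
    finally show "Re (c i * l2_inner (\<phi> i) p) \<le> (B * (cmod (c i))\<^sup>2 + (cmod (l2_inner p (\<phi> i)))\<^sup>2 / B) / 2" .
  qed
  also have "\<dots> = (B * (\<Sum>i\<in>X. (cmod (c i))\<^sup>2) + (\<Sum>i\<in>X. (cmod (l2_inner p (\<phi> i)))\<^sup>2) / B) / 2"
    by (simp add: sum.distrib sum_distrib_left sum_divide_distrib add_divide_distrib)
  also have "\<dots> \<le> (B * (\<Sum>i\<in>X. (cmod (c i))\<^sup>2) + (l2_norm p)\<^sup>2) / 2"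
    using finite_bound[OF p X] B by (simp add: field_simps)
  finally show ?thesis unfolding p_def by simp
qed

lemma filterlim_boxes:
  "filterlim (\<lambda>k::nat. {- int k..int k} \<times> {- int k..int k}) (finite_subsets_at_top UNIV) sequentially"
  unfolding filterlim_finite_subsets_at_top
proof (intro allI impI)
  fix X :: "(int \<times> int) set" assume X: "finite X \<and> X \<subseteq> UNIV"
  have "\<forall>\<^sub>F k in sequentially. fst ` X \<subseteq> {- int k..int k} \<and> snd ` X \<subseteq> {- int k..int k}"
    using filterlim_symmetric_intervals[unfolded filterlim_finite_subsets_at_top] X
    by (intro eventually_conj) (fastforce elim: eventually_mono)+
  then show "\<forall>\<^sub>F k in sequentially. finite ({- int k..int k} \<times> {- int k..int k})
      \<and> X \<subseteq> {- int k..int k} \<times> {- int k..int k} \<and> {- int k..int k} \<times> {- int k..int k} \<subseteq> UNIV"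
    by eventually_elim force
qed

text \<open>Partial sums over growing boxes form a Cauchy sequence, because their differences are
  synthesised from tails of a convergent series. The conclusion records the expansion weakly, the
  form in which the trace argument reads it.\<close>

lemma frame_operator_exists:
  assumes f: "f \<in> L2"
  shows "\<exists>u\<in>L2. \<forall>h\<in>L2. ((\<lambda>i. l2_inner f (\<phi> i) * l2_inner (\<phi> i) h) has_sum l2_inner u h) UNIV"
proof -
  define c where "c i = l2_inner f (\<phi> i)" for i
  define F where "F k = {- int k..int k} \<times> {- int k..int k}" for k :: nat
  define p where "p k = (\<lambda>x. \<Sum>i\<in>F k. c i * \<phi> i x)" for k
  define s where "s k = (\<Sum>i\<in>F k. (cmod (c i))\<^sup>2)" for k
  have F: "finite (F k)" for k by (simp add: F_def)
  have F_mono: "F n \<subseteq> F m" if "n \<le> m" for n m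
    using that by (auto simp: F_def)
  have p: "p k \<in> L2" for k unfolding p_def by (intro L2_sum L2_scale \<phi>)
  have step: "(l2_norm (\<lambda>x. p m x - p n x))\<^sup>2 \<le> B * \<bar>s m - s n\<bar>" if "n \<le> m" for n m
  proof -
    have "p m x - p n x = (\<Sum>i\<in>F m - F n. c i * \<phi> i x)" for x
      unfolding p_def using F F_mono[OF that] by (subst sum_diff) auto
    moreover have "s m - s n = (\<Sum>i\<in>F m - F n. (cmod (c i))\<^sup>2)"
      unfolding s_def using F F_mono[OF that] by (subst sum_diff) auto
    moreover have "0 \<le> (\<Sum>i\<in>F m - F n. (cmod (c i))\<^sup>2)" by (intro sum_nonneg) auto
    ultimately show ?thesis using synthesis_bound[of "F m - F n" c] F by simp
  qed
  have step': "(l2_norm (\<lambda>x. p m x - p n x))\<^sup>2 \<le> B * \<bar>s m - s n\<bar>" for n m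
    using step[of n m] step[of m n] l2_norm_minus_commute[of "p m" "p n"]
    by (cases "n \<le> m") (auto simp: abs_minus_commute)
  have "(\<lambda>i. (cmod (c i))\<^sup>2) summable_on UNIV" unfolding c_def by (rule summable[OF f])
  then have "s \<longlonglongrightarrow> (\<Sum>\<^sub>\<infinity>i. (cmod (c i))\<^sup>2)"
    unfolding s_def F_def by (intro filterlim_compose[OF _ filterlim_boxes] has_sum_infsum[unfolded has_sum_def])
  then have sC: "Cauchy s" by (rule LIMSEQ_imp_Cauchy)
  obtain u where u: "u \<in> L2" "(\<lambda>k. l2_norm (\<lambda>x. u x - p k x)) \<longlonglongrightarrow> 0"
  proof (rule L2_complete[OF p])
    fix e :: real assume e: "e > 0"
    then have "e\<^sup>2 / B > 0" using B by simp
    then obtain N where N: "\<And>m n. m \<ge> N \<Longrightarrow> n \<ge> N \<Longrightarrow> \<bar>s m - s n\<bar> < e\<^sup>2 / B"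
      using sC unfolding Cauchy_def dist_real_def by blast
    have "l2_norm (\<lambda>x. p m x - p n x) < e" if "m \<ge> N" "n \<ge> N" for m n
    proof (rule power2_less_imp_less)
      show "(l2_norm (\<lambda>x. p m x - p n x))\<^sup>2 < e\<^sup>2"
        using step'[of m n] N[OF that] B by (simp add: field_simps)
    qed (use e in simp)
    then show "\<exists>N. \<forall>m\<ge>N. \<forall>n\<ge>N. l2_norm (\<lambda>x. p m x - p n x) < e" by blast
  qed
  have "((\<lambda>i. c i * l2_inner (\<phi> i) h) has_sum l2_inner u h) UNIV" if h: "h \<in> L2" for h
  proof -
    \<comment> \<open>Absolute summability makes the sum unconditional; the boxes only identify its
      value.\<close>
    have "(\<lambda>i. (cmod (c i))\<^sup>2 + (cmod (l2_inner h (\<phi> i)))\<^sup>2) summable_on UNIV"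
      unfolding c_def by (intro summable_on_add summable f h)
    then have "(\<lambda>i. norm (c i * l2_inner (\<phi> i) h)) summable_on UNIV"
    proof (rule Infinite_Sum.abs_summable_on_comparison_test')
      fix i
      have "cmod (c i) * cmod (l2_inner h (\<phi> i)) \<le> (cmod (c i))\<^sup>2 + (cmod (l2_inner h (\<phi> i)))\<^sup>2"
        using sum_squares_bound[of "cmod (c i)" "cmod (l2_inner h (\<phi> i))"]
          mult_nonneg_nonneg[OF norm_ge_zero norm_ge_zero, of "c i" "l2_inner h (\<phi> i)"] by linarith
      then show "norm (c i * l2_inner (\<phi> i) h) \<le> (cmod (c i))\<^sup>2 + (cmod (l2_inner h (\<phi> i)))\<^sup>2"
        using l2_inner_commute[of h "\<phi> i"] by (simp add: norm_mult)
    qed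
    then have "(\<lambda>i. c i * l2_inner (\<phi> i) h) summable_on UNIV" by (rule abs_summable_summable)
    then obtain t where t: "((\<lambda>i. c i * l2_inner (\<phi> i) h) has_sum t) UNIV"
      by (auto simp: summable_on_def)
    have "(\<lambda>k. \<Sum>i\<in>F k. c i * l2_inner (\<phi> i) h) \<longlonglongrightarrow> t"
      unfolding F_def using filterlim_compose[OF t[unfolded has_sum_def] filterlim_boxes] .
    moreover have "(\<Sum>i\<in>F k. c i * l2_inner (\<phi> i) h) = l2_inner (p k) h" for k
      unfolding p_def by (subst l2_inner_sum_left) (auto simp: l2_inner_scale_left intro: L2_scale \<phi> h)
    ultimately have "(\<lambda>k. l2_inner (p k) h) \<longlonglongrightarrow> t" by simp
    moreover have "(\<lambda>k. l2_inner (p k) h) \<longlonglongrightarrow> l2_inner u h"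
    proof (rule LIM_zero_cancel, rule Lim_null_comparison)
      show "\<forall>\<^sub>F k in sequentially. norm (l2_inner (p k) h - l2_inner u h) \<le> l2_norm (\<lambda>x. u x - p k x) * l2_norm h"
      proof (rule always_eventually, rule allI)
        fix k
        have "norm (l2_inner (p k) h - l2_inner u h) = cmod (l2_inner (\<lambda>x. u x - p k x) h)"
          using u(1) p h by (simp add: l2_inner_diff_left norm_minus_commute)
        also have "\<dots> \<le> l2_norm (\<lambda>x. u x - p k x) * l2_norm h"
          by (intro l2_Cauchy_Schwarz L2_diff u(1) p h)
        finally show "norm (l2_inner (p k) h - l2_inner u h) \<le> l2_norm (\<lambda>x. u x - p k x) * l2_norm h" .
      qed
      show "(\<lambda>k. l2_norm (\<lambda>x. u x - p k x) * l2_norm h) \<longlonglongrightarrow> 0"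
        using tendsto_mult_right[OF u(2), of "l2_norm h"] by simp
    qed
    ultimately have "t = l2_inner u h" by (rule LIMSEQ_unique)
    then show ?thesis using t by simp
  qed
  then show ?thesis using u(1) unfolding c_def by blast
qed

text \<open>The value is fixed only up to null sets, hence the choice. Identities about it,
  linearity included, hold against test functions in L2 rather than pointwise.\<close>

definition frame_op :: "(real \<Rightarrow> complex) \<Rightarrow> real \<Rightarrow> complex" where
  "frame_op f = (SOME u. u \<in> L2 \<and>
     (\<forall>h\<in>L2. ((\<lambda>i. l2_inner f (\<phi> i) * l2_inner (\<phi> i) h) has_sum l2_inner u h) UNIV))"

lemma frame_op:
  assumes "f \<in> L2"
  shows frame_op_L2: "frame_op f \<in> L2"
    and frame_op_has_sum: "h \<in> L2 \<Longrightarrow>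
      ((\<lambda>i. l2_inner f (\<phi> i) * l2_inner (\<phi> i) h) has_sum l2_inner (frame_op f) h) UNIV"
  using someI_ex[of "\<lambda>u. u \<in> L2 \<and>
     (\<forall>h\<in>L2. ((\<lambda>i. l2_inner f (\<phi> i) * l2_inner (\<phi> i) h) has_sum l2_inner u h) UNIV)"]
    frame_operator_exists[OF assms] unfolding frame_op_def by blast+

lemma frame_op_self:
  assumes "f \<in> L2"
  shows "((\<lambda>i. (cmod (l2_inner f (\<phi> i)))\<^sup>2) has_sum Re (l2_inner (frame_op f) f)) UNIV"
proof -
  have "l2_inner f (\<phi> i) * l2_inner (\<phi> i) f = of_real ((cmod (l2_inner f (\<phi> i)))\<^sup>2)" for i
    by (subst l2_inner_commute[of "\<phi> i"]) (simp flip: complex_norm_square of_real_power)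
  then have "((\<lambda>i. complex_of_real ((cmod (l2_inner f (\<phi> i)))\<^sup>2)) has_sum l2_inner (frame_op f) f) UNIV"
    using frame_op_has_sum[OF assms assms] by simp
  from has_sum_Re[OF this] show ?thesis by simp
qed

lemma frame_op_sym:
  assumes "f \<in> L2" "h \<in> L2"
  shows "l2_inner (frame_op f) h = l2_inner f (frame_op h)"
proof -
  have "((\<lambda>i. cnj (l2_inner h (\<phi> i) * l2_inner (\<phi> i) f)) has_sum cnj (l2_inner (frame_op h) f)) UNIV"
    using frame_op_has_sum[OF assms(2,1)] by (simp only: has_sum_cnj_iff)
  also have "(\<lambda>i. cnj (l2_inner h (\<phi> i) * l2_inner (\<phi> i) f)) = (\<lambda>i. l2_inner f (\<phi> i) * l2_inner (\<phi> i) h)"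
    by (simp add: l2_inner_commute[of h] l2_inner_commute[of _ f] mult.commute)
  finally show ?thesis
    using has_sum_unique frame_op_has_sum[OF assms] l2_inner_commute[of f "frame_op h"] by metis
qed

lemma frame_op_nonneg: "f \<in> L2 \<Longrightarrow> 0 \<le> Re (l2_inner (frame_op f) f)"
  by (rule has_sum_nonneg[OF frame_op_self]) auto

lemma frame_op_le: "f \<in> L2 \<Longrightarrow> Re (l2_inner (frame_op f) f) \<le> B * (l2_norm f)\<^sup>2"
  using bound[of f] infsumI[OF frame_op_self, of f] by simp

lemma frame_op_ge_term:
  assumes "f \<in> L2"
  shows "(cmod (l2_inner f (\<phi> i)))\<^sup>2 \<le> Re (l2_inner (frame_op f) f)"
  using finite_sum_le_has_sum[OF frame_op_self[OF assms], of "{i}"] by simp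

section \<open>Powers of a positive contraction\<close>

text \<open>Dividing by the Bessel bound puts this symmetric operator between 0 and the identity as
  a quadratic form.\<close>

definition T :: "(real \<Rightarrow> complex) \<Rightarrow> real \<Rightarrow> complex" where
  "T f = (\<lambda>x. f x - of_real (1 / B) * frame_op f x)"

abbreviation Tn :: "nat \<Rightarrow> (real \<Rightarrow> complex) \<Rightarrow> real \<Rightarrow> complex" where
  "Tn k \<equiv> T ^^ k"

lemma T_L2: "f \<in> L2 \<Longrightarrow> T f \<in> L2"
  unfolding T_def by (intro L2_diff L2_scale frame_op_L2)

lemma T_inner:
  assumes "f \<in> L2" "h \<in> L2"
  shows "l2_inner (T f) h = l2_inner f h - of_real (1 / B) * l2_inner (frame_op f) h"
  unfolding T_def
  by (simp only: l2_inner_diff_left[OF assms(1) L2_scale[OF frame_op_L2[OF assms(1)]] assms(2)]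
      l2_inner_scale_left)

lemma T_sym:
  assumes "f \<in> L2" "h \<in> L2"
  shows "l2_inner (T f) h = l2_inner f (T h)"
proof -
  have "l2_inner f (T h) = cnj (l2_inner (T h) f)" by (rule l2_inner_commute)
  also have "\<dots> = l2_inner f h - of_real (1 / B) * l2_inner f (frame_op h)"
    unfolding T_inner[OF assms(2,1)] by (simp flip: l2_inner_commute)
  finally show ?thesis using T_inner[OF assms] frame_op_sym[OF assms] by simp
qed

lemma Tn_L2: "f \<in> L2 \<Longrightarrow> Tn k f \<in> L2"
  by (induction k) (auto intro: T_L2)

lemma Tn_sym:
  assumes "f \<in> L2" "h \<in> L2"
  shows "l2_inner (Tn k f) h = l2_inner f (Tn k h)"
  using assms(2)
proof (induction k arbitrary: h)
  case (Suc k)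
  have "l2_inner (Tn (Suc k) f) h = l2_inner (Tn k f) (T h)"
    using T_sym[OF Tn_L2[OF assms(1)] Suc.prems] by simp
  also have "\<dots> = l2_inner f (Tn k (T h))" using Suc.IH[OF T_L2[OF Suc.prems]] .
  finally show ?case by (simp add: funpow_swap1)
qed simp

lemma Tn_add: "l2_inner (Tn (i + j) f) h = l2_inner (Tn i f) (Tn j h)" if "f \<in> L2" "h \<in> L2"
  using Tn_sym[OF Tn_L2[OF that(1)] that(2), of j i] by (simp add: funpow_add add.commute[of i])

lemma T_nonneg:
  assumes f: "f \<in> L2"
  shows "0 \<le> Re (l2_inner (T f) f)"
  unfolding T_inner[OF f f] using frame_op_le[OF f] B by (simp add: Re_l2_inner_self field_simps)

lemma T_le:
  assumes f: "f \<in> L2"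
  shows "Re (l2_inner (T f) f) \<le> (l2_norm f)\<^sup>2"
  unfolding T_inner[OF f f] using frame_op_nonneg[OF f] B by (simp add: Re_l2_inner_self)

text \<open>T - T^2 = T (1 - T) T + (1 - T) T (1 - T), a sum of two positive operators. With w = T f
  and u = S f their positivity reads <S w, w> \<ge> 0 and <S u, u> \<le> B |u|^2.\<close>

lemma T_square_le:
  assumes f: "f \<in> L2"
  shows "(l2_norm (T f))\<^sup>2 \<le> Re (l2_inner (T f) f)"
proof -
  define w where "w = T f"
  define u where "u = frame_op f"
  have L: "w \<in> L2" "u \<in> L2" using f by (simp_all add: w_def u_def T_L2 frame_op_L2)
  have w: "l2_inner w h = l2_inner f h - of_real (1 / B) * l2_inner u h" if "h \<in> L2" for h
    unfolding w_def u_def by (rule T_inner[OF f that])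
  have w': "l2_inner h w = l2_inner h f - of_real (1 / B) * l2_inner h u" if "h \<in> L2" for h
    using w[OF that] by (subst (1 2 3) l2_inner_commute) simp
  have "l2_inner (frame_op w) w = l2_inner w u - of_real (1 / B) * l2_inner (frame_op w) u"
    using w'[OF frame_op_L2[OF L(1)]] frame_op_sym[OF L(1) f] by (simp add: u_def)
  also have "l2_inner (frame_op w) u = l2_inner w (frame_op u)"
    by (rule frame_op_sym[OF L])
  also have "\<dots> = l2_inner u u - of_real (1 / B) * l2_inner u (frame_op u)"
    using w[OF frame_op_L2[OF L(2)]] frame_op_sym[OF f L(2)] by (simp add: u_def)
  finally have "Re (l2_inner (frame_op w) w)
      = Re (l2_inner f u) - 2 * (l2_norm u)\<^sup>2 / B + Re (l2_inner u (frame_op u)) / B\<^sup>2"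
    using w[OF L(2)] by (simp add: Re_l2_inner_self right_diff_distrib power2_eq_square)
  moreover have "Re (l2_inner u (frame_op u)) / B\<^sup>2 \<le> (l2_norm u)\<^sup>2 / B"
    using frame_op_le[OF L(2)] frame_op_sym[OF L(2) L(2)] B by (simp add: field_simps power2_eq_square)
  ultimately have *: "(l2_norm u)\<^sup>2 / B \<le> Re (l2_inner f u)"
    using frame_op_nonneg[OF L(1)] by linarith
  have "(l2_norm w)\<^sup>2 = Re (l2_inner f w) - Re (l2_inner u w) / B"
    unfolding Re_l2_inner_self[symmetric] using w[OF L(1)] by simp
  also have "Re (l2_inner u w) = Re (l2_inner f u) - (l2_norm u)\<^sup>2 / B"
    unfolding w'[OF L(2)] l2_inner_commute[of u f] by (simp add: Re_l2_inner_self)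
  finally have "(l2_norm w)\<^sup>2 \<le> Re (l2_inner f w)"
    using * B by simp
  then show ?thesis using l2_inner_commute[of f w] by (simp add: w_def)
qed

lemma T_contraction: "f \<in> L2 \<Longrightarrow> l2_norm (T f) \<le> l2_norm f"
  by (rule power2_le_imp_le[OF order_trans[OF T_square_le T_le]]) auto

lemma Tn_contraction: "f \<in> L2 \<Longrightarrow> l2_norm (Tn k f) \<le> l2_norm f"
  by (induction k) (auto intro: order_trans[OF T_contraction] Tn_L2)

lemma Tn_even: "f \<in> L2 \<Longrightarrow> Re (l2_inner (Tn (i + i) f) f) = (l2_norm (Tn i f))\<^sup>2"
  by (simp add: Tn_add Re_l2_inner_self)

lemma Tn_odd: "f \<in> L2 \<Longrightarrow> Re (l2_inner (Tn (Suc (i + i)) f) f) = Re (l2_inner (T (Tn i f)) (Tn i f))"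
  using Tn_add[of f f "Suc i" i] by simp

text \<open>An even power gives the squared norm of T^i f, an odd one the quadratic form of T at T^i
  f.\<close>

lemma Tn_nonneg:
  assumes f: "f \<in> L2"
  shows "0 \<le> Re (l2_inner (Tn k f) f)"
proof (cases "even k")
  case True
  then obtain i where "k = i + i" by (auto elim!: evenE simp: mult_2)
  then show ?thesis by (simp only: Tn_even[OF f]) simp
next
  case False
  then obtain i where "k = Suc (i + i)" by (auto elim!: oddE simp: mult_2)
  then show ?thesis by (simp only: Tn_odd[OF f] T_nonneg[OF Tn_L2[OF f]])
qed

text \<open>A step from an even power uses T \<le> 1, a step from an odd power uses T^2 \<le>
  T.\<close>

lemma Tn_decreasing:
  assumes f: "f \<in> L2"
  shows "Re (l2_inner (Tn (Suc k) f) f) \<le> Re (l2_inner (Tn k f) f)"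
proof (cases "even k")
  case True
  then obtain i where "k = i + i" by (auto elim!: evenE simp: mult_2)
  then show ?thesis by (simp only: Tn_even[OF f] Tn_odd[OF f] T_le[OF Tn_L2[OF f]])
next
  case False
  then obtain i where i: "k = Suc (i + i)" by (auto elim!: oddE simp: mult_2)
  then have "Suc k = Suc i + Suc i" by simp
  then show ?thesis
    unfolding i using T_square_le[OF Tn_L2[OF f], of i] Tn_even[OF f, of "Suc i"]
    by (simp only: Tn_odd[OF f]) simp
qed

lemma Tn_antimono:
  assumes f: "f \<in> L2" and "j \<le> k"
  shows "Re (l2_inner (Tn k f) f) \<le> Re (l2_inner (Tn j f) f)"
  using assms(2)
proof (induction rule: dec_induct)
  case (step n)
  then show ?case using Tn_decreasing[OF f, of n] by linarith
qed simp

section \<open>Neumann partial sums and decay of the powers of T\<close>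

definition dual_approx :: "nat \<Rightarrow> (real \<Rightarrow> complex) \<Rightarrow> real \<Rightarrow> complex" where
  "dual_approx k f = (\<lambda>x. \<Sum>j<k. of_real (1 / B) * Tn j f x)"

lemma dual_approx_L2: "f \<in> L2 \<Longrightarrow> dual_approx k f \<in> L2"
  unfolding dual_approx_def by (intro L2_sum L2_scale Tn_L2)

lemma dual_approx_inner:
  assumes "f \<in> L2" "h \<in> L2"
  shows "l2_inner (dual_approx k f) h = (\<Sum>j<k. of_real (1 / B) * l2_inner (Tn j f) h)"
  unfolding dual_approx_def
  by (subst l2_inner_sum_left[OF L2_scale[OF Tn_L2[OF assms(1)]] assms(2)]) (simp only: l2_inner_scale_left)

lemma frame_op_Tn:
  assumes "f \<in> L2" "h \<in> L2"
  shows "of_real (1 / B) * l2_inner (frame_op (Tn k f)) h = l2_inner (Tn k f) h - l2_inner (Tn (Suc k) f) h"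
  using T_inner[OF Tn_L2[OF assms(1)] assms(2), of k] by simp

text \<open>Since S = B (1 - T), applying S to the Neumann partial sum telescopes to 1 -
  T^k.\<close>

lemma frame_op_dual_approx:
  assumes f: "f \<in> L2" and h: "h \<in> L2"
  shows "l2_inner (frame_op (dual_approx k f)) h = l2_inner f h - l2_inner (Tn k f) h"
proof -
  \<comment> \<open>Symmetry moves S to the other argument: \<open>frame_op\<close> is a choice, so
    it is not additive as a map on functions.\<close>
  have "l2_inner (frame_op (dual_approx k f)) h = l2_inner (dual_approx k f) (frame_op h)"
    by (intro frame_op_sym dual_approx_L2 f h)
  also have "\<dots> = (\<Sum>j<k. of_real (1 / B) * l2_inner (frame_op (Tn j f)) h)"
    using f h by (simp add: dual_approx_inner frame_op_L2 frame_op_sym Tn_L2)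
  also have "\<dots> = (\<Sum>j<k. l2_inner (Tn j f) h - l2_inner (Tn (Suc j) f) h)"
    by (simp only: frame_op_Tn[OF f h])
  also have "\<dots> = l2_inner f h - l2_inner (Tn k f) h"
    by (subst sum_lessThan_telescope') simp
  finally show ?thesis .
qed

text \<open>With \<open>x\<close> the value bounded here, \<open>x\<^sup>2\<close> is a single term of the frame sum of
  the approximate dual, while that whole sum is at most \<open>x\<close>.\<close>

lemma dual_approx_le_1: "Re (l2_inner (dual_approx k (\<phi> i)) (\<phi> i)) \<le> 1"
proof -
  define \<gamma> where "\<gamma> = dual_approx k (\<phi> i)"
  define x where "x = Re (l2_inner \<gamma> (\<phi> i))"
  have \<gamma>: "\<gamma> \<in> L2" unfolding \<gamma>_def by (intro dual_approx_L2 \<phi>)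
  have "x\<^sup>2 \<le> (cmod (l2_inner \<gamma> (\<phi> i)))\<^sup>2"
    unfolding x_def cmod_power2 by simp
  also have "\<dots> \<le> Re (l2_inner (frame_op \<gamma>) \<gamma>)" by (rule frame_op_ge_term[OF \<gamma>])
  also have "l2_inner (frame_op \<gamma>) \<gamma> = l2_inner (\<phi> i) \<gamma> - l2_inner (Tn k (\<phi> i)) \<gamma>"
    unfolding \<gamma>_def by (intro frame_op_dual_approx \<phi> dual_approx_L2)
  also have "Re \<dots> = x - Re (l2_inner (Tn k (\<phi> i)) \<gamma>)"
    unfolding x_def l2_inner_commute[of "\<phi> i"] by simp
  also have "\<dots> \<le> x"
  proof -
    have "l2_inner \<gamma> (Tn k (\<phi> i)) = (\<Sum>j<k. of_real (1 / B) * l2_inner (Tn (j + k) (\<phi> i)) (\<phi> i))"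
      unfolding \<gamma>_def by (subst dual_approx_inner) (simp_all add: \<phi> Tn_L2 Tn_add)
    then have "0 \<le> Re (l2_inner \<gamma> (Tn k (\<phi> i)))"
      using B by (auto intro!: sum_nonneg divide_nonneg_nonneg Tn_nonneg \<phi>)
    then show ?thesis using l2_inner_commute[of \<gamma> "Tn k (\<phi> i)"] by simp
  qed
  finally have "x * x \<le> x * 1" by (simp add: power2_eq_square)
  then show ?thesis unfolding x_def[symmetric] \<gamma>_def[symmetric]
    by (cases "x \<le> 0") (auto simp: mult_le_cancel_left)
qed

text \<open>The moments a k decrease, and their first k terms sum to B times <gamma_k, \<phi> i>,
  hence to at most B. So k a k \<le> B, and the squared norm of T^k \<phi> i is the moment of order
  2k.\<close>

lemma Tn_generator_tendsto_0: "(\<lambda>k. l2_norm (Tn k (\<phi> i))) \<longlonglongrightarrow> 0"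
proof -
  define a where "a k = Re (l2_inner (Tn k (\<phi> i)) (\<phi> i))" for k
  have a: "real k * a k \<le> B" for k
  proof -
    have "real k * a k / B = (\<Sum>j<k. a k / B)" by simp
    also have "\<dots> \<le> (\<Sum>j<k. a j / B)"
      unfolding a_def using B by (intro sum_mono divide_right_mono Tn_antimono \<phi>) auto
    also have "\<dots> = Re (l2_inner (dual_approx k (\<phi> i)) (\<phi> i))"
      by (simp add: dual_approx_inner \<phi> a_def)
    also have "\<dots> \<le> 1" by (rule dual_approx_le_1)
    finally show ?thesis using B by (simp add: field_simps)
  qed
  have "(\<lambda>k. (l2_norm (Tn k (\<phi> i)))\<^sup>2) \<longlonglongrightarrow> 0"
  proof (rule Lim_null_comparison)
    show "\<forall>\<^sub>F k in sequentially. norm ((l2_norm (Tn k (\<phi> i)))\<^sup>2) \<le> B * inverse (real k)"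
      using eventually_gt_at_top[of 0]
    proof eventually_elim
      case (elim k)
      have "real k * (l2_norm (Tn k (\<phi> i)))\<^sup>2 = real k * a (k + k)" by (simp add: a_def Tn_even \<phi>)
      also have "\<dots> \<le> real (k + k) * a (k + k)"
        unfolding a_def by (intro mult_right_mono Tn_nonneg \<phi>) auto
      also have "\<dots> \<le> B" by (rule a)
      finally have "real k * (l2_norm (Tn k (\<phi> i)))\<^sup>2 \<le> B" .
      then show ?case using elim by (simp add: field_simps)
    qed
    show "(\<lambda>k. B * inverse (real k)) \<longlonglongrightarrow> 0"
      using tendsto_mult_right_zero[OF lim_inverse_n] .
  qed
  then have "(\<lambda>k. sqrt ((l2_norm (Tn k (\<phi> i)))\<^sup>2)) \<longlonglongrightarrow> sqrt 0"
    by (rule tendsto_real_sqrt)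
  then show ?thesis by simp
qed

text \<open>By symmetry T^k may act on the generator, where it decays in norm. Linearity extends the
  decay to the span; contractivity of T^k makes the approximation error uniform in k. This is where
  completeness of the system enters.\<close>

lemma Tn_tendsto_0:
  assumes f: "f \<in> L2" and dense: "\<And>e. e > 0 \<Longrightarrow> \<exists>h\<in>lin_span (range \<phi>). l2_norm (\<lambda>x. f x - h x) < e"
  shows "(\<lambda>k. l2_inner (Tn k f) f) \<longlonglongrightarrow> 0"
proof -
  have gen: "(\<lambda>k. l2_inner (Tn k f) (\<phi> i)) \<longlonglongrightarrow> 0" for i
  proof (rule Lim_null_comparison)
    show "\<forall>\<^sub>F k in sequentially. norm (l2_inner (Tn k f) (\<phi> i)) \<le> l2_norm f * l2_norm (Tn k (\<phi> i))"
      by (intro always_eventually allI)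
         (simp only: Tn_sym[OF f \<phi>] l2_Cauchy_Schwarz[OF f Tn_L2[OF \<phi>]])
    show "(\<lambda>k. l2_norm f * l2_norm (Tn k (\<phi> i))) \<longlonglongrightarrow> 0"
      by (intro tendsto_mult_right_zero Tn_generator_tendsto_0)
  qed
  have span: "(\<lambda>k. l2_inner (Tn k f) p) \<longlonglongrightarrow> 0" if p: "p \<in> lin_span (range \<phi>)" for p
  proof -
    obtain F c where F: "finite F" "F \<subseteq> range \<phi>" "p = (\<lambda>x. \<Sum>u\<in>F. c u * u x)"
      using p unfolding lin_span_def by blast
    have FL: "u \<in> L2" if "u \<in> F" for u using F(2) that \<phi> by auto
    have "l2_inner (Tn k f) p = (\<Sum>u\<in>F. cnj (c u) * l2_inner (Tn k f) u)" for k
      unfolding F(3)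
      by (subst l2_inner_sum_right) (use FL in \<open>auto simp: l2_inner_scale_right intro: L2_scale Tn_L2 f\<close>)
    moreover have "(\<lambda>k. \<Sum>u\<in>F. cnj (c u) * l2_inner (Tn k f) u) \<longlonglongrightarrow> 0"
      using F(2) gen by (intro tendsto_null_sum tendsto_mult_right_zero) auto
    ultimately show ?thesis by simp
  qed
  show ?thesis
  proof (rule LIMSEQ_I)
    fix e :: real assume e: "e > 0"
    define e' where "e' = e / (2 * (l2_norm f + 1))"
    have e': "e' > 0" using e by (simp add: e'_def add_nonneg_pos)
    obtain p where p: "p \<in> lin_span (range \<phi>)" "l2_norm (\<lambda>x. f x - p x) < e'"
      using dense[OF e'] by blast
    have pL: "p \<in> L2" using \<phi> by (intro lin_span_L2[OF _ p(1)]) auto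
    obtain K where K: "\<And>k. k \<ge> K \<Longrightarrow> norm (l2_inner (Tn k f) p) < e / 2"
      using LIMSEQ_D[OF span[OF p(1)], of "e / 2"] e by auto
    have "norm (l2_inner (Tn k f) f) < e" if "k \<ge> K" for k
    proof -
      have "l2_inner (Tn k f) f = l2_inner (Tn k f) p + l2_inner (Tn k f) (\<lambda>x. f x - p x)"
        using l2_inner_diff_right[OF f pL Tn_L2[OF f]] by simp
      then have "norm (l2_inner (Tn k f) f) \<le> norm (l2_inner (Tn k f) p) + norm (l2_inner (Tn k f) (\<lambda>x. f x - p x))"
        by (metis norm_triangle_ineq)
      also have "norm (l2_inner (Tn k f) (\<lambda>x. f x - p x)) \<le> l2_norm (Tn k f) * l2_norm (\<lambda>x. f x - p x)"
        by (intro l2_Cauchy_Schwarz Tn_L2 L2_diff f pL)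
      also have "\<dots> \<le> (l2_norm f + 1) * e'"
        using Tn_contraction[OF f, of k] p(2) by (intro mult_mono) auto
      also have "\<dots> = e / 2"
        unfolding e'_def using add_nonneg_pos[OF l2_norm_nonneg[of f] zero_less_one]
        by (simp add: field_simps)
      finally show ?thesis using K[OF that] by simp
    qed
    then show "\<exists>no. \<forall>k\<ge>no. norm (l2_inner (Tn k f) f - 0) < e" by auto
  qed
qed

end


section \<open>Gabor systems\<close>

lemma gabor_apply: "gabor f a b m n x = chi (of_int m * b) x * f (x - of_int n * a)"
  by (simp add: gabor_def modulation_apply translation_def)

lemma gabor_L2:
  assumes "f \<in> L2"
  shows "gabor f a b m n \<in> L2"
proof (rule L2_I)
  note [measurable] = L2_D(1)[OF assms]
  show "gabor f a b m n \<in> borel_measurable borel"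
    unfolding gabor_apply[abs_def] by measurable
  show "integrable lborel (\<lambda>x. (cmod (gabor f a b m n x))\<^sup>2)"
    using lborel_integrable_real_affine[OF L2_D(2)[OF assms], of 1 "- (of_int n * a)"]
    by (simp add: gabor_apply norm_mult)
qed

lemma integral_translate:
  fixes f :: "real \<Rightarrow> complex"
  shows "(LINT x|lborel. f (x - t)) = (LINT x|lborel. f x)"
  using lborel_integral_real_affine[of 1 f "- t"] by simp

lemma gabor_inner: "l2_inner (gabor f a b m n) (gabor h a b m n) = l2_inner f h"
proof -
  have "gabor f a b m n x * cnj (gabor h a b m n x)
      = (\<lambda>y. f y * cnj (h y)) (x - of_int n * a)" for x
  proof -
    have "gabor f a b m n x * cnj (gabor h a b m n x) = (chi (of_int m * b) x * cnj (chi (of_int m * b) x))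
        * (f (x - of_int n * a) * cnj (h (x - of_int n * a)))"
      by (simp only: gabor_apply complex_cnj_mult mult_ac)
    then show ?thesis by simp
  qed
  then show ?thesis
    unfolding l2_inner_def
    using integral_translate[of "\<lambda>y. f y * cnj (h y)" "of_int n * a"] by simp
qed

text \<open>A time-frequency shift maps onto L2, so a weak identity may be tested on shifted
  functions alone.\<close>

lemma gabor_surj:
  assumes "h \<in> L2"
  obtains k where "k \<in> L2" "h = gabor k a b m n"
proof (rule that)
  let ?k = "gabor (\<lambda>x. cnj (chi (of_int m * b) x) * h x) a b 0 (- n)"
  have "(\<lambda>x. cnj (chi (of_int m * b) x) * h x) \<in> L2"
    by (rule L2_bound[OF assms]) (use L2_D(1)[OF assms] in \<open>auto simp: norm_mult
        intro!: borel_measurable_times measurable_compose[OF _ borel_measurable_cnj]\<close>)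
  then show "?k \<in> L2" by (rule gabor_L2)
  show "h = gabor ?k a b m n"
    by (rule ext) (simp add: gabor_apply mult.assoc[symmetric])
qed

text \<open>Two shifts compose to a shift up to a phase independent of x. In the frame operator each
  Gabor element occurs once in either slot, so the phase meets its conjugate.\<close>

lemma gabor_shift:
  "gabor g a b (m + m') (n + n')
    = (\<lambda>x. chi (of_int m' * b) (of_int n * a) * gabor (gabor g a b m' n') a b m n x)"
proof
  fix x
  have "chi (of_int m' * b) (of_int n * a) * gabor (gabor g a b m' n') a b m n x
     = (chi (of_int m' * b) (of_int n * a) * cnj (chi (of_int m' * b) (of_int n * a)))
       * (chi (of_int m * b) x * chi (of_int m' * b) x) * g (x - of_int n * a - of_int n' * a)"
    by (simp only: gabor_apply chi_diff_arg mult_ac)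
  also have "\<dots> = gabor g a b (m + m') (n + n') x"
    by (simp add: gabor_apply chi_add[symmetric] distrib_right diff_diff_eq)
  finally show "gabor g a b (m + m') (n + n') x
     = chi (of_int m' * b) (of_int n * a) * gabor (gabor g a b m' n') a b m n x" by (rule sym)
qed

section \<open>Covariance of the frame operator under time-frequency shifts\<close>

locale gabor_bessel = bessel "\<lambda>(m, n). gabor g a b m n" B for g a b B +
  assumes g: "g \<in> L2" and a: "a > 0" and b: "b > 0"
begin

text \<open>Reindexing the lattice by the translation (m, n) turns the sum for the shifted pair into
  the sum for f and h, with all phases cancelling.\<close>

lemma frame_op_gabor:
  assumes f: "f \<in> L2" and h: "h \<in> L2"
  shows "l2_inner (frame_op (gabor f a b m n)) (gabor h a b m n) = l2_inner (frame_op f) h"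
proof -
  let ?\<phi> = "\<lambda>(m, n). gabor g a b m n"
  let ?f = "gabor f a b m n" and ?h = "gabor h a b m n"
  have bij: "bij_betw (\<lambda>(m', n'). (m + m', n + n')) UNIV UNIV"
    by (rule bij_betwI[of _ _ _ "\<lambda>(m', n'). (m' - m, n' - n)"]) auto
  have "((\<lambda>i. l2_inner ?f (?\<phi> i) * l2_inner (?\<phi> i) ?h) has_sum l2_inner (frame_op ?f) ?h) UNIV"
    by (intro frame_op_has_sum gabor_L2 f h)
  then have "((\<lambda>i. l2_inner ?f (?\<phi> ((\<lambda>(m', n'). (m + m', n + n')) i))
        * l2_inner (?\<phi> ((\<lambda>(m', n'). (m + m', n + n')) i)) ?h)
      has_sum l2_inner (frame_op ?f) ?h) UNIV"
    by (simp only: has_sum_reindex_bij_betw[OF bij, of "\<lambda>i. l2_inner ?f (?\<phi> i) * l2_inner (?\<phi> i) ?h"])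
  moreover have "l2_inner ?f (?\<phi> ((\<lambda>(m', n'). (m + m', n + n')) i))
        * l2_inner (?\<phi> ((\<lambda>(m', n'). (m + m', n + n')) i)) ?h
      = l2_inner f (?\<phi> i) * l2_inner (?\<phi> i) h" for i
  proof -
    obtain m' n' where i: "i = (m', n')" by (cases i)
    define z where "z = chi (of_int m' * b) (of_int n * a)"
    have z: "cnj z * z = 1" unfolding z_def by (subst mult.commute) simp
    have "l2_inner ?f (gabor g a b (m + m') (n + n')) * l2_inner (gabor g a b (m + m') (n + n')) ?h
        = (cnj z * z) * (l2_inner ?f (gabor (gabor g a b m' n') a b m n) * l2_inner (gabor (gabor g a b m' n') a b m n) ?h)"
      unfolding gabor_shift[of g a b m m' n n'] l2_inner_scale_left l2_inner_scale_right z_def[symmetric]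
      by (simp only: mult_ac)
    then show ?thesis unfolding i z gabor_inner by simp
  qed
  ultimately have "((\<lambda>i. l2_inner f (?\<phi> i) * l2_inner (?\<phi> i) h) has_sum l2_inner (frame_op ?f) ?h) UNIV"
    by simp
  then show ?thesis using frame_op_has_sum[OF f h] by (rule has_sum_unique)
qed

lemma T_gabor:
  assumes f: "f \<in> L2" and h: "h \<in> L2"
  shows "l2_inner (T (gabor f a b m n)) h = l2_inner (gabor (T f) a b m n) h"
proof -
  obtain k where k: "k \<in> L2" "h = gabor k a b m n" by (rule gabor_surj[OF h])
  show ?thesis
    unfolding k(2) by (simp only: T_inner[OF gabor_L2[OF f] gabor_L2[OF k(1)]] gabor_inner
        frame_op_gabor[OF f k(1)] T_inner[OF f k(1)])
qed

text \<open>\<open>T_gabor\<close> holds only against test functions, so it cannot be rewritten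
  underneath T. One factor is moved onto the test function, where the induction hypothesis applies,
  and is moved back afterwards.\<close>

lemma Tn_gabor:
  assumes f: "f \<in> L2" and h: "h \<in> L2"
  shows "l2_inner (Tn k (gabor f a b m n)) h = l2_inner (gabor (Tn k f) a b m n) h"
  using h
proof (induction k arbitrary: h)
  case (Suc k)
  have "l2_inner (Tn (Suc k) (gabor f a b m n)) h = l2_inner (Tn k (gabor f a b m n)) (T h)"
    using T_sym[OF Tn_L2[OF gabor_L2[OF f]] Suc.prems] by simp
  also have "\<dots> = l2_inner (gabor (Tn k f) a b m n) (T h)"
    by (rule Suc.IH[OF T_L2[OF Suc.prems]])
  also have "\<dots> = l2_inner (T (gabor (Tn k f) a b m n)) h"
    by (rule T_sym[symmetric, OF gabor_L2[OF Tn_L2[OF f]] Suc.prems])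
  also have "\<dots> = l2_inner (gabor (Tn (Suc k) f) a b m n) h"
    using T_gabor[OF Tn_L2[OF f] Suc.prems] by simp
  finally show ?case .
qed simp

text \<open>The weak form of 1 - T^k as analysis with g followed by synthesis with gamma_k, tested
  on f itself. The j-th Neumann term contributes <T^j f, f> - <T^(j+1) f, f>: covariance turns the
  power acting on the window into one acting on f.\<close>

lemma dual_approx_expansion:
  assumes f: "f \<in> L2"
  shows "((\<lambda>(m, n). l2_inner f (gabor g a b m n) * l2_inner (gabor (dual_approx k g) a b m n) f)
     has_sum (l2_inner f f - l2_inner (Tn k f) f)) UNIV"
proof -
  let ?c = "of_real (1 / B) :: complex"
  have "((\<lambda>(m, n). l2_inner f (gabor g a b m n) * (\<Sum>j<k. ?c * l2_inner (gabor (Tn j g) a b m n) f))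
     has_sum (l2_inner f f - l2_inner (Tn k f) f)) UNIV"
  proof (induction k)
    case (Suc k)
    have "((\<lambda>i. ?c * (l2_inner f (case i of (m, n) \<Rightarrow> gabor g a b m n) * l2_inner (case i of (m, n) \<Rightarrow> gabor g a b m n) (Tn k f)))
       has_sum ?c * l2_inner (frame_op f) (Tn k f)) UNIV"
      by (intro has_sum_cmult_right frame_op_has_sum f Tn_L2)
    also have "?c * l2_inner (frame_op f) (Tn k f) = l2_inner (Tn k f) f - l2_inner (Tn (Suc k) f) f"
      using T_inner[OF f Tn_L2[OF f, of k]] Tn_sym[OF f f, of k] Tn_add[OF f f, of 1 k] by simp
    also have "(\<lambda>i. ?c * (l2_inner f (case i of (m, n) \<Rightarrow> gabor g a b m n) * l2_inner (case i of (m, n) \<Rightarrow> gabor g a b m n) (Tn k f)))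
       = (\<lambda>(m, n). l2_inner f (gabor g a b m n) * (?c * l2_inner (gabor (Tn k g) a b m n) f))"
    proof
      fix i :: "int \<times> int"
      obtain m n where i: "i = (m, n)" by (cases i)
      have "l2_inner (gabor g a b m n) (Tn k f) = l2_inner (gabor (Tn k g) a b m n) f"
        using Tn_sym[OF gabor_L2[OF g] f] Tn_gabor[OF g f] by simp
      then show "?c * (l2_inner f (case i of (m, n) \<Rightarrow> gabor g a b m n) * l2_inner (case i of (m, n) \<Rightarrow> gabor g a b m n) (Tn k f))
          = (case i of (m, n) \<Rightarrow> l2_inner f (gabor g a b m n) * (?c * l2_inner (gabor (Tn k g) a b m n) f))"
        unfolding i by simp
    qed
    finally have "((\<lambda>(m, n). l2_inner f (gabor g a b m n) * (?c * l2_inner (gabor (Tn k g) a b m n) f))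
       has_sum l2_inner (Tn k f) f - l2_inner (Tn (Suc k) f) f) UNIV" .
    from has_sum_add[OF Suc this] show ?case
      by (simp add: case_prod_unfold distrib_left)
  qed simp
  moreover have "l2_inner (gabor (dual_approx k g) a b m n) f = (\<Sum>j<k. ?c * l2_inner (gabor (Tn j g) a b m n) f)" for m n
  proof -
    have "gabor (dual_approx k g) a b m n = (\<lambda>x. \<Sum>j<k. ?c * gabor (Tn j g) a b m n x)"
      by (rule ext) (simp only: gabor_apply dual_approx_def sum_distrib_left mult_ac)
    then show ?thesis
      by (simp only: l2_inner_sum_left[OF L2_scale[OF gabor_L2[OF Tn_L2[OF g]]] f] l2_inner_scale_left)
  qed
  ultimately show ?thesis by simp
qed

end

section \<open>Trace on short intervals and the density bound\<close>

lemma indicator_L2: "(indicator {c..<c + d} :: real \<Rightarrow> complex) \<in> L2"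
  by (rule L2_bounded_support[where c = c and d = "c + d" and M = 1]) (auto simp: indicator_def)

lemma indicator_inner:
  assumes "d \<ge> 0"
  shows "l2_inner (indicator {c..<c + d}) (indicator {c..<c + d}) = of_real d"
proof -
  have "l2_inner (indicator {c..<c + d}) (indicator {c..<c + d})
     = (LINT x|lborel. indicator {c..<c + d} x *\<^sub>R (1::complex))"
    unfolding l2_inner_def by (rule arg_cong[of _ _ "integral\<^sup>L lborel"]) (auto simp: indicator_def)
  also have "\<dots> = measure lborel {c..<c + d} *\<^sub>R 1"
    by (subst integral_scaleR_left) (use assms in auto)
  finally show ?thesis using assms by (simp add: scaleR_conv_of_real)
qed

text \<open>Regrouping the integrand leaves a pure tone in the second slot, ready for Parseval. The
  condition d \<le> 1/b places the indicator inside one period.\<close>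

lemma indicator_gabor_inner:
  assumes b: "b > 0" and d: "d \<le> 1 / b"
  shows "l2_inner (indicator {c..<c + d}) (gabor h a b m n)
    = l2_inner (\<lambda>x. indicator {c..<c + d} x * cnj (h (x - of_int n * a))) (window_tone b c m)"
  unfolding l2_inner_def
  by (rule arg_cong[of _ _ "integral\<^sup>L lborel"])
     (use d in \<open>auto simp: gabor_apply window_tone_def indicator_def\<close>)

text \<open>For fixed n, the sum over modulations is Parseval on one period and yields the integral
  of \<gamma> times the conjugate of g over the interval translated by -n a.\<close>

lemma gabor_rows:
  assumes b: "b > 0" and d: "d \<le> 1 / b" and g: "g \<in> L2" and \<gamma>: "\<gamma> \<in> L2"
  shows "((\<lambda>m. l2_inner (indicator {c..<c + d}) (gabor g a b m n) * l2_inner (gabor \<gamma> a b m n) (indicator {c..<c + d}))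
    has_sum (LINT x:{c - of_int n * a..<c - of_int n * a + d}|lborel. \<gamma> x * cnj (g x)) / of_real b) UNIV"
proof -
  let ?J = "{c..<c + d}"
  let ?k = "\<lambda>h x. indicator ?J x * cnj (h (x - of_int n * a))"
  have kL: "?k h \<in> L2" if h: "h \<in> L2" for h
  proof (rule L2_bound[OF gabor_L2[OF h]])
    note [measurable] = L2_D(1)[OF h]
    show "?k h \<in> borel_measurable borel"
      by (intro borel_measurable_times borel_measurable_indicator
          measurable_compose[OF _ borel_measurable_cnj]) measurable
    show "cmod (?k h x) \<le> cmod (gabor h a b 0 n x)" for x
      by (simp add: gabor_apply norm_mult indicator_def)
  qed
  have ks: "?k h x = 0" if "x \<notin> {c..<c + 1 / b}" for h x
    using that d by (auto simp: indicator_def)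
  have "((\<lambda>m. l2_inner (?k g) (window_tone b c m) * cnj (l2_inner (?k \<gamma>) (window_tone b c m)))
      has_sum l2_inner (?k g) (?k \<gamma>) / of_real b) UNIV"
    by (intro parseval_interval_inner b kL g \<gamma> ks)
  also have "l2_inner (?k g) (?k \<gamma>)
      = (LINT x|lborel. (\<lambda>y. indicator {c - of_int n * a..<c - of_int n * a + d} y *\<^sub>R (\<gamma> y * cnj (g y))) (x - of_int n * a))"
    unfolding l2_inner_def by (rule arg_cong[of _ _ "integral\<^sup>L lborel"]) (auto simp: indicator_def)
  also have "\<dots> = (LINT x:{c - of_int n * a..<c - of_int n * a + d}|lborel. \<gamma> x * cnj (g x))"
    unfolding set_lebesgue_integral_def by (rule integral_translate)
  finally show ?thesis
    unfolding indicator_gabor_inner[OF b d, symmetric]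
    by (simp flip: l2_inner_commute)
qed

lemma sum_set_integral_intervals:
  fixes F :: "real \<Rightarrow> 'a::{banach, second_countable_topology}"
  assumes F: "integrable lborel F" and d: "d \<ge> 0"
  shows "(\<Sum>i<q. LINT x:{c + real i * d..<c + real i * d + d}|lborel. F x) = (LINT x:{c..<c + real q * d}|lborel. F x)"
proof (induction q)
  case (Suc q)
  have int: "set_integrable lborel A F" if "A \<in> sets borel" for A
    unfolding set_integrable_def using F that by (intro integrable_mult_indicator) auto
  have split: "{c..<c + real (Suc q) * d} = {c..<c + real q * d} \<union> {c + real q * d..<c + real q * d + d}"
    using d by (subst ivl_disj_un_two(3)) (auto simp: algebra_simps)
  have "(LINT x:{c..<c + real (Suc q) * d}|lborel. F x)
     = (LINT x:{c..<c + real q * d}|lborel. F x) + (LINT x:{c + real q * d..<c + real q * d + d}|lborel. F x)"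
    unfolding split by (intro set_integral_Un int) auto
  then show ?case using Suc by simp
qed (simp add: set_lebesgue_integral_def)

lemma has_sum_finite_sum:
  fixes f :: "'i \<Rightarrow> 'b \<Rightarrow> 'c::topological_comm_monoid_add"
  assumes "\<And>i. i \<in> I \<Longrightarrow> (f i has_sum s i) A"
  shows "((\<lambda>x. \<Sum>i\<in>I. f i x) has_sum (\<Sum>i\<in>I. s i)) A"
  using assms by (induction I rule: infinite_finite_induct) (auto intro: has_sum_add)

context gabor_bessel
begin

text \<open>Evaluating the approximate expansion on indicators of intervals tiling \<open>[0, a)\<close>
  computes a trace per unit cell in two ways.\<close>

lemma trace_identity:
  assumes q: "q > 0" and d: "d = a / real q" "d \<le> 1 / b"
  shows "l2_inner (dual_approx k g) g / of_real b
    = of_real a - (\<Sum>i<q. l2_inner (Tn k (indicator {real i * d..<real i * d + d})) (indicator {real i * d..<real i * d + d}))"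
proof -
  define \<gamma> where "\<gamma> = dual_approx k g"
  define F where "F x = \<gamma> x * cnj (g x)" for x
  have \<gamma>: "\<gamma> \<in> L2" unfolding \<gamma>_def by (intro dual_approx_L2 g)
  have F: "integrable lborel F" unfolding F_def by (intro L2_integrable_prod \<gamma> g)
  have d0: "d \<ge> 0" and qd: "real q * d = a" using q a by (simp_all add: d)
  define J :: "nat \<Rightarrow> real \<Rightarrow> complex" where "J i = indicator {real i * d..<real i * d + d}" for i
  define t where "t i = l2_inner (Tn k (J i)) (J i)" for i
  have rows: "((\<lambda>n. (LINT x:{real i * d - of_int n * a..<real i * d - of_int n * a + d}|lborel. F x) / of_real b)
      has_sum (of_real d - t i)) UNIV" for i
  proof (rule has_sum_SigmaD)
    have "((\<lambda>(m, n). l2_inner (J i) (gabor g a b m n) * l2_inner (gabor \<gamma> a b m n) (J i))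
        has_sum (of_real d - t i)) (UNIV \<times> UNIV)"
      using dual_approx_expansion[OF indicator_L2, of "real i * d" d k] indicator_inner[OF d0]
      by (simp add: J_def \<gamma>_def t_def)
    then show "((\<lambda>(n, m). l2_inner (J i) (gabor g a b m n) * l2_inner (gabor \<gamma> a b m n) (J i))
        has_sum (of_real d - t i)) (UNIV \<times> UNIV)"
      by (subst (asm) has_sum_swap) (simp add: case_prod_unfold)
    show "((\<lambda>m. case (n, m) of (n, m) \<Rightarrow> l2_inner (J i) (gabor g a b m n) * l2_inner (gabor \<gamma> a b m n) (J i))
        has_sum (LINT x:{real i * d - of_int n * a..<real i * d - of_int n * a + d}|lborel. F x) / of_real b) UNIV" for n
      using gabor_rows[OF b d(2) g \<gamma>, of "real i * d" a n] by (simp add: J_def F_def)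
  qed
  have "((\<lambda>n. \<Sum>i<q. (LINT x:{real i * d - of_int n * a..<real i * d - of_int n * a + d}|lborel. F x) / of_real b)
      has_sum (\<Sum>i<q. of_real d - t i)) UNIV"
    by (intro has_sum_finite_sum rows)
  also have "(\<Sum>i<q. of_real d - t i) = of_real a - (\<Sum>i<q. t i)"
    by (simp add: sum_subtractf qd[symmetric])
  \<comment> \<open>For fixed n the q short intervals join to the cell [-n a, -n a + a); the cells
    tile the line as n varies.\<close>
  also have "(\<lambda>n. \<Sum>i<q. (LINT x:{real i * d - of_int n * a..<real i * d - of_int n * a + d}|lborel. F x) / of_real b)
      = (\<lambda>n. (LINT x:{of_int (- n) * a..<of_int (- n) * a + a}|lborel. F x) / of_real b)"
  proof
    fix n :: int
    show "(\<Sum>i<q. (LINT x:{real i * d - of_int n * a..<real i * d - of_int n * a + d}|lborel. F x) / of_real b)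
      = (LINT x:{of_int (- n) * a..<of_int (- n) * a + a}|lborel. F x) / of_real b"
      using sum_set_integral_intervals[OF F d0, of "of_int (- n) * a" q]
      unfolding qd sum_divide_distrib[symmetric] by (simp add: algebra_simps)
  qed
  finally have "((\<lambda>n. (LINT x:{of_int (- n) * a..<of_int (- n) * a + a}|lborel. F x) / of_real b)
      has_sum of_real a - (\<Sum>i<q. t i)) UNIV" .
  moreover have "((\<lambda>n. (LINT x:{of_int (- n) * a..<of_int (- n) * a + a}|lborel. F x) / of_real b)
      has_sum (LINT x|lborel. F x) / of_real b) UNIV"
  proof -
    have "bij_betw uminus UNIV (UNIV :: int set)" by (rule bij_betwI[of _ _ _ uminus]) auto
    from has_sum_reindex_bij_betw[OF this, THEN iffD2, OF has_sum_integral_intervals[OF F a]]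
    show ?thesis unfolding divide_inverse by (intro has_sum_cmult_left)
  qed
  ultimately have "of_real a - (\<Sum>i<q. t i) = (LINT x|lborel. F x) / of_real b"
    by (rule has_sum_unique)
  then show ?thesis by (simp add: l2_inner_def F_def \<gamma>_def t_def J_def)
qed

theorem complete_imp_density:
  assumes complete: "\<And>f e. f \<in> L2 \<Longrightarrow> e > 0 \<Longrightarrow>
    \<exists>h\<in>lin_span (range (\<lambda>(m, n). gabor g a b m n)). l2_norm (\<lambda>x. f x - h x) < e"
  shows "a * b \<le> 1"
proof -
  \<comment> \<open>The least number of equal pieces of [0, a) that are no longer than the period
    1/b.\<close>
  define q where "q = nat \<lceil>a * b\<rceil>"
  define d where "d = a / real q"
  have ab: "a * b > 0" using a b by simp
  then have q: "q > 0" and "a * b \<le> real q" unfolding q_def by linarith+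
  then have d: "d \<le> 1 / b" unfolding d_def using b by (simp add: field_simps)
  define J :: "nat \<Rightarrow> real \<Rightarrow> complex" where "J i = indicator {real i * d..<real i * d + d}" for i
  have "(\<lambda>k. of_real a - (\<Sum>i<q. l2_inner (Tn k (J i)) (J i))) \<longlonglongrightarrow> of_real a - (\<Sum>i<q. 0)"
    unfolding J_def by (intro tendsto_intros Tn_tendsto_0 indicator_L2 complete)
  then have "(\<lambda>k. Re (of_real a - (\<Sum>i<q. l2_inner (Tn k (J i)) (J i)))) \<longlonglongrightarrow> a"
    by (auto dest: tendsto_Re)
  moreover have "Re (of_real a - (\<Sum>i<q. l2_inner (Tn k (J i)) (J i))) \<le> 1 / b" for k
  proof -
    have "gabor g a b 0 0 = g" by (rule ext) (simp add: gabor_apply)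
    then have "Re (l2_inner (dual_approx k g) g) \<le> 1"
      using dual_approx_le_1[of k "(0, 0)"] by simp
    then have "Re (l2_inner (dual_approx k g) g / of_real b) \<le> 1 / b"
      using b by (simp add: divide_right_mono)
    then show ?thesis unfolding trace_identity[OF q d_def d] J_def .
  qed
  ultimately have "a \<le> 1 / b" by (intro LIMSEQ_le_const2) auto
  then show ?thesis using b by (simp add: field_simps)
qed

end


section \<open>Information packets are complete\<close>

text \<open>Some finite partial sum of the packet expansion is within e / 2 of f, and each of its
  terms is approximated from its own span.\<close>

lemma information_packet_complete:
  assumes packet: "information_packet J (\<lambda>j. closed_span (S j))"
    and S: "\<And>j. j \<in> J \<Longrightarrow> S j \<subseteq> R" "R \<subseteq> L2"
    and f: "f \<in> L2" and e: "e > 0"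
  shows "\<exists>h\<in>lin_span R. l2_norm (\<lambda>x. f x - h x) < e"
proof -
  obtain u where u: "\<And>j. j \<in> J \<Longrightarrow> u j \<in> closed_span (S j)" and sum: "l2_has_sum u f J"
    using packet f unfolding information_packet_def by blast
  have "\<forall>\<^sub>F X in finite_subsets_at_top J. l2_norm (\<lambda>x. f x - (\<Sum>j\<in>X. u j x)) < e / 2"
    using sum e unfolding l2_has_sum_def by (intro order_tendstoD) auto
  then obtain X where X: "finite X" "X \<subseteq> J" "l2_norm (\<lambda>x. f x - (\<Sum>j\<in>X. u j x)) < e / 2"
    by (auto simp: eventually_finite_subsets_at_top)
  \<comment> \<open>The remaining e / 2 is shared among the terms; the summand 1 covers an empty
    X.\<close>
  define e' where "e' = e / (2 * (real (card X) + 1))"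
  have e': "e' > 0" using e by (simp add: e'_def add_nonneg_pos)
  have "\<exists>h. h \<in> lin_span (S j) \<and> l2_norm (\<lambda>x. u j x - h x) < e'" if "j \<in> X" for j
    using closed_span_approx[OF u e', of j] that X(2) by blast
  then obtain h where h: "\<And>j. j \<in> X \<Longrightarrow> h j \<in> lin_span (S j)"
    "\<And>j. j \<in> X \<Longrightarrow> l2_norm (\<lambda>x. u j x - h j x) < e'"
    by metis
  have hR: "h j \<in> lin_span R" if "j \<in> X" for j
    using h(1)[OF that] lin_span_mono[OF S(1)] that X(2) by blast
  have hL: "h j \<in> L2" if "j \<in> X" for j by (rule lin_span_L2[OF S(2) hR[OF that]])
  have uL: "u j \<in> L2" if "j \<in> X" for j
    using u that X(2) by (auto simp: closed_span_def l2_closure_def)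
  let ?u = "\<lambda>x. \<Sum>j\<in>X. u j x" and ?h = "\<lambda>x. \<Sum>j\<in>X. h j x"
  have "l2_norm (\<lambda>x. ?u x - ?h x) = l2_norm (\<lambda>x. \<Sum>j\<in>X. u j x - h j x)"
    by (simp add: sum_subtractf)
  also have "\<dots> \<le> (\<Sum>j\<in>X. l2_norm (\<lambda>x. u j x - h j x))"
    by (intro l2_norm_sum_le L2_diff uL hL)
  also have "\<dots> \<le> (\<Sum>j\<in>X. e')" by (intro sum_mono less_imp_le h(2))
  also have "\<dots> \<le> (real (card X) + 1) * e'" using e' by (simp add: distrib_right)
  also have "\<dots> = e / 2" by (simp add: e'_def add_nonneg_pos field_simps)
  finally have "l2_norm (\<lambda>x. ?u x - ?h x) \<le> e / 2" .
  then have "l2_norm (\<lambda>x. f x - ?h x) < e"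
    using l2_norm_triangle3[OF f L2_sum[of X u, OF uL] L2_sum[of X h, OF hL]] X(3) by simp
  moreover have "?h \<in> lin_span R" by (intro lin_span_sum hR)
  ultimately show ?thesis by (rule bexI)
qed

text \<open>The system with translation step N a is the subfamily of the frame with n in N Z, so its
  sums of nonnegative terms are bounded by those of the frame.\<close>

lemma gabor_bessel_sublattice:
  assumes frame: "gabor_frame g a b" and a: "a > 0" and b: "b > 0" and N: "N > 0" and g: "g \<in> L2"
  obtains B where "gabor_bessel g (real N * a) b B"
proof -
  obtain B where B: "B > 0"
    and sm: "\<And>f. f \<in> L2 \<Longrightarrow> (\<lambda>i. (cmod (l2_inner f (case i of (m, n) \<Rightarrow> gabor g a b m n)))\<^sup>2) summable_on UNIV"
    and bd: "\<And>f. f \<in> L2 \<Longrightarrow> (\<Sum>\<^sub>\<infinity>i. (cmod (l2_inner f (case i of (m, n) \<Rightarrow> gabor g a b m n)))\<^sup>2) \<le> B * (l2_norm f)\<^sup>2"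
    using frame unfolding gabor_frame_def is_frame_def by auto
  define \<iota> where "\<iota> = (\<lambda>(m::int, n::int). (m, int N * n))"
  have inj: "inj \<iota>" using N by (auto simp: inj_def \<iota>_def)
  have eq: "(case i of (m, n) \<Rightarrow> gabor g (real N * a) b m n) = (case \<iota> i of (m, n) \<Rightarrow> gabor g a b m n)" for i
    by (cases i) (auto simp: \<iota>_def gabor_apply[abs_def] mult_ac)
  have "gabor_bessel g (real N * a) b B"
  proof unfold_locales
    show "(case i of (m, n) \<Rightarrow> gabor g (real N * a) b m n) \<in> L2" for i
      by (cases i) (simp add: gabor_L2 g)
    fix f assume f: "f \<in> L2"
    let ?c = "\<lambda>i. (cmod (l2_inner f (case i of (m, n) \<Rightarrow> gabor g a b m n)))\<^sup>2"
    have sub: "?c summable_on range \<iota>" by (rule summable_on_subset_banach[OF sm[OF f]]) simp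
    then show "(\<lambda>i. (cmod (l2_inner f (case i of (m, n) \<Rightarrow> gabor g (real N * a) b m n)))\<^sup>2) summable_on UNIV"
      unfolding eq using summable_on_reindex[OF inj, of ?c] by (simp add: o_def)
    have "(\<Sum>\<^sub>\<infinity>i. (cmod (l2_inner f (case i of (m, n) \<Rightarrow> gabor g (real N * a) b m n)))\<^sup>2) = infsum ?c (range \<iota>)"
      unfolding eq using infsum_reindex[OF inj, of ?c] by (simp add: o_def)
    also have "\<dots> \<le> infsum ?c UNIV"
      by (rule infsum_mono_neutral[OF sub sm[OF f]]) auto
    also have "\<dots> \<le> B * (l2_norm f)\<^sup>2" by (rule bd[OF f])
    finally show "(\<Sum>\<^sub>\<infinity>i. (cmod (l2_inner f (case i of (m, n) \<Rightarrow> gabor g (real N * a) b m n)))\<^sup>2) \<le> B * (l2_norm f)\<^sup>2" .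
  qed (use B a b N g in auto)
  then show ?thesis by (rule that)
qed

lemma not_woven_large:
  assumes frame: "gabor_frame g a b" and a: "a > 0" and b: "b > 0" and g: "g \<in> L2"
    and N: "real N * (a * b) > 1"
    and woven: "woven N (UNIV :: int set) (\<lambda>l n. V g a b (int N * n + int l - 1))"
  shows False
proof -
  have N0: "N > 0" using N by (cases N) auto
  obtain B where "gabor_bessel g (real N * a) b B"
    by (rule gabor_bessel_sublattice[OF frame a b N0 g])
  then interpret gabor_bessel g "real N * a" b B .
  let ?\<phi> = "\<lambda>(m, n). gabor g (real N * a) b m n"
  \<comment> \<open>The case l = 1 has indices N n + 1 - 1 = N n, exactly the thinned
    lattice.\<close>
  have "information_packet UNIV (\<lambda>n. V g a b (int N * n + int 1 - 1))"
    using woven N0 unfolding woven_def by (metis atLeastAtMost_iff le_refl less_one not_less)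
  moreover have "V g a b (int N * n + int 1 - 1) = closed_span (range (\<lambda>m. ?\<phi> (m, n)))" for n
  proof -
    have "gabor g a b m (int N * n) = gabor g (real N * a) b m n" for m
      by (rule ext) (simp add: gabor_apply mult_ac)
    then show ?thesis by (simp add: V_def)
  qed
  ultimately have packet: "information_packet UNIV (\<lambda>n. closed_span (range (\<lambda>m. ?\<phi> (m, n))))"
    by simp
  have "real N * a * b \<le> 1"
  proof (rule complete_imp_density)
    fix f e assume "f \<in> L2" "(e::real) > 0"
    then show "\<exists>h\<in>lin_span (range ?\<phi>). l2_norm (\<lambda>x. f x - h x) < e"
      by (intro information_packet_complete[OF packet]) (auto intro: gabor_L2 g)
  qed
  then show False using N by (simp add: mult.assoc)
qed

section \<open>Rectangular windows\<close>

locale rectangular_window =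
  fixes N :: nat
  assumes N: "N > 0"
begin

text \<open>Makes the period 1/b equal to the window length, so that the Gabor elements are
  orthogonal tones on each window.\<close>

definition b :: real where "b = 1 / (2 * real N)"

definition g :: "real \<Rightarrow> complex" where "g = indicator {0..<2 * real N}"

lemma b: "b > 0" and inverse_b: "1 / b = 2 * real N"
  using N by (simp_all add: b_def)

lemma g_L2: "g \<in> L2"
  using indicator_L2[of 0 "2 * real N"] by (simp add: g_def)

lemma gabor_eq_window_tone: "gabor g 1 b m n = window_tone b (of_int n) m"
  by (rule ext) (auto simp: gabor_apply window_tone_def inverse_b g_def indicator_def)

lemma restrict_L2:
  assumes "f \<in> L2" "A \<in> sets borel"
  shows "(\<lambda>x. indicator A x * f x) \<in> L2"
proof (rule L2_bound[OF assms(1)])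
  note [measurable] = L2_D(1)[OF assms(1)] assms(2)
  show "(\<lambda>x. indicator A x * f x) \<in> borel_measurable borel" by measurable
qed (auto simp: indicator_def)

text \<open>The modulations of the translated window form the whole trigonometric system of that
  interval, which is complete there.\<close>

lemma supported_in_V:
  assumes f: "f \<in> L2" and supp: "\<And>x. x \<notin> {of_int n..<of_int n + 2 * real N} \<Longrightarrow> f x = 0"
  shows "f \<in> V g 1 b n"
  unfolding V_def closed_span_def l2_closure_def gabor_eq_window_tone
proof (intro CollectI conjI allI impI f)
  fix e :: real assume e: "e > 0"
  obtain F d where "finite F" and d: "l2_norm (\<lambda>x. f x - (\<Sum>m\<in>F. d m * window_tone b (of_int n) m x)) < e"
    by (rule window_tone_approx[OF b f _ e]) (auto simp: supp inverse_b)
  show "\<exists>h\<in>lin_span (range (window_tone b (of_int n))). l2_norm (\<lambda>x. f x - h x) < e"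
  proof (rule bexI)
    show "l2_norm (\<lambda>x. f x - (\<Sum>m\<in>F. d m * window_tone b (of_int n) m x)) < e" by (rule d)
    show "(\<lambda>x. \<Sum>m\<in>F. d m * window_tone b (of_int n) m x) \<in> lin_span (range (window_tone b (of_int n)))"
      by (intro lin_span_sum lin_span_scale lin_span_base) auto
  qed
qed

lemma frame_rows:
  assumes f: "f \<in> L2"
  shows "((\<lambda>m. (cmod (l2_inner f (gabor g 1 b m n)))\<^sup>2) has_sum
     2 * real N * (LINT x:{of_int n..<of_int n + 2 * real N}|lborel. (cmod (f x))\<^sup>2)) UNIV"
proof -
  let ?I = "{of_int n..<of_int n + 2 * real N}"
  let ?f = "\<lambda>x. indicator ?I x * f x"
  have "((\<lambda>m. (cmod (l2_inner ?f (window_tone b (of_int n) m)))\<^sup>2) has_sum (l2_norm ?f)\<^sup>2 / b) UNIV"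
    by (intro parseval_interval b restrict_L2 f) (auto simp: inverse_b)
  moreover have "l2_inner ?f (window_tone b (of_int n) m) = l2_inner f (gabor g 1 b m n)" for m
    unfolding gabor_eq_window_tone l2_inner_def
    by (rule arg_cong[of _ _ "integral\<^sup>L lborel"]) (auto simp: window_tone_def inverse_b indicator_def)
  moreover have "(l2_norm ?f)\<^sup>2 = (LINT x:?I|lborel. (cmod (f x))\<^sup>2)"
    unfolding l2_norm_sq set_lebesgue_integral_def
    by (rule arg_cong[of _ _ "integral\<^sup>L lborel"]) (auto simp: indicator_def)
  ultimately show ?thesis using inverse_b by (simp add: b_def mult.commute)
qed

text \<open>One factor 2N is 1/b from Parseval on each window; the other counts the 2N windows that
  cover each point.\<close>

lemma frame_identity:
  assumes f: "f \<in> L2"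
  shows "((\<lambda>(m, n). (cmod (l2_inner f (gabor g 1 b m n)))\<^sup>2) has_sum (2 * real N)\<^sup>2 * (l2_norm f)\<^sup>2) UNIV"
proof -
  let ?F = "\<lambda>x. (cmod (f x))\<^sup>2"
  \<comment> \<open>Each window is cut into 2N unit intervals. For a fixed offset i these tile the
    line as n varies, so every offset contributes the full squared norm.\<close>
  have "((\<lambda>n. \<Sum>i<2 * N. LINT x:{of_int n + real i * 1..<of_int n + real i * 1 + 1}|lborel. ?F x)
      has_sum (\<Sum>i<2 * N. (l2_norm f)\<^sup>2)) (UNIV :: int set)"
  proof (rule has_sum_finite_sum)
    fix i
    have "bij_betw (\<lambda>n. n + int i) UNIV UNIV" by (rule bij_betwI[of _ _ _ "\<lambda>n. n - int i"]) auto
    from has_sum_reindex_bij_betw[OF this, THEN iffD2, OF has_sum_integral_intervals[OF L2_D(2)[OF f], of 1]]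
    show "((\<lambda>n. LINT x:{of_int n + real i * 1..<of_int n + real i * 1 + 1}|lborel. ?F x)
      has_sum (l2_norm f)\<^sup>2) (UNIV :: int set)"
      by (simp add: l2_norm_sq)
  qed
  then have "((\<lambda>n. LINT x:{of_int n..<of_int n + 2 * real N}|lborel. ?F x) has_sum 2 * real N * (l2_norm f)\<^sup>2) (UNIV :: int set)"
    unfolding sum_set_integral_intervals[OF L2_D(2)[OF f] zero_le_one] by simp
  then have cols: "((\<lambda>n. 2 * real N * (LINT x:{of_int n..<of_int n + 2 * real N}|lborel. ?F x))
      has_sum 2 * real N * (2 * real N * (l2_norm f)\<^sup>2)) (UNIV :: int set)"
    by (rule has_sum_cmult_right)
  have "((\<lambda>(n, m). (cmod (l2_inner f (gabor g 1 b m n)))\<^sup>2) has_sum 2 * real N * (2 * real N * (l2_norm f)\<^sup>2)) (UNIV \<times> UNIV)"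
  proof (rule has_sum_SigmaI[OF _ cols])
    show "(\<lambda>(n, m). (cmod (l2_inner f (gabor g 1 b m n)))\<^sup>2) summable_on UNIV \<times> UNIV"
    proof (rule summable_on_SigmaI)
      show "(\<lambda>n. 2 * real N * (LINT x:{of_int n..<of_int n + 2 * real N}|lborel. ?F x)) summable_on (UNIV :: int set)"
        using cols by (auto simp: summable_on_def)
    qed (use frame_rows[OF f] in auto)
  qed (use frame_rows[OF f] in auto)
  then show ?thesis
    by (subst (asm) has_sum_swap) (simp add: case_prod_unfold power2_eq_square mult.assoc)
qed

lemma frame: "gabor_frame g 1 b"
  unfolding gabor_frame_def is_frame_def
proof (intro conjI ballI)
  show "(case i of (m, n) \<Rightarrow> gabor g 1 b m n) \<in> L2" for i
    by (cases i) (simp add: gabor_L2 g_L2)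
  show "\<exists>A>0. \<exists>B>0. \<forall>f\<in>L2. (\<lambda>i. (cmod (l2_inner f (case i of (m, n) \<Rightarrow> gabor g 1 b m n)))\<^sup>2) summable_on UNIV
      \<and> A * (l2_norm f)\<^sup>2 \<le> (\<Sum>\<^sub>\<infinity>i. (cmod (l2_inner f (case i of (m, n) \<Rightarrow> gabor g 1 b m n)))\<^sup>2)
      \<and> (\<Sum>\<^sub>\<infinity>i. (cmod (l2_inner f (case i of (m, n) \<Rightarrow> gabor g 1 b m n)))\<^sup>2) \<le> B * (l2_norm f)\<^sup>2"
  proof (intro exI[of _ "(2 * real N)\<^sup>2"] conjI ballI)
    fix f assume f: "f \<in> L2"
    have *: "((\<lambda>i. (cmod (l2_inner f (case i of (m, n) \<Rightarrow> gabor g 1 b m n)))\<^sup>2) has_sum (2 * real N)\<^sup>2 * (l2_norm f)\<^sup>2) UNIV"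
      using frame_identity[OF f] by (simp add: case_prod_unfold)
    show "(\<lambda>i. (cmod (l2_inner f (case i of (m, n) \<Rightarrow> gabor g 1 b m n)))\<^sup>2) summable_on UNIV"
      using * by (auto simp: summable_on_def)
    show "(2 * real N)\<^sup>2 * (l2_norm f)\<^sup>2 \<le> (\<Sum>\<^sub>\<infinity>i. (cmod (l2_inner f (case i of (m, n) \<Rightarrow> gabor g 1 b m n)))\<^sup>2)"
      and "(\<Sum>\<^sub>\<infinity>i. (cmod (l2_inner f (case i of (m, n) \<Rightarrow> gabor g 1 b m n)))\<^sup>2) \<le> (2 * real N)\<^sup>2 * (l2_norm f)\<^sup>2"
      using infsumI[OF *] by simp_all
  qed (use N in auto)
qed

text \<open>A selected window \<open>[\<nu> j, \<nu> j + 2N)\<close> contains the block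
  \<open>[N(\<tau> j + 1), N(\<tau> j + 2))\<close>, and these blocks tile the line.\<close>

lemma information_packet_selection:
  fixes \<nu> \<tau> :: "'j \<Rightarrow> int"
  assumes bij: "bij_betw \<tau> J UNIV"
    and \<nu>: "\<And>j. j \<in> J \<Longrightarrow> int N * \<tau> j \<le> \<nu> j" "\<And>j. j \<in> J \<Longrightarrow> \<nu> j \<le> int N * \<tau> j + int N"
  shows "information_packet J (\<lambda>j. V g 1 b (\<nu> j))"
  unfolding information_packet_def
proof (intro conjI ballI)
  show "closed_subspace (V g 1 b (\<nu> j))" for j
    unfolding V_def by (rule closed_subspace_closed_span) (auto intro: gabor_L2 g_L2)
next
  fix f assume f: "f \<in> L2"
  define D where "D j = {of_int (\<tau> j + 1) * real N..<of_int (\<tau> j + 1) * real N + real N}" for j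
  define u where "u j = (\<lambda>x. indicator (D j) x * f x)" for j
  let ?E = "\<lambda>j. LINT x:D j|lborel. (cmod (f x))\<^sup>2"
  have D: "x \<in> D j \<longleftrightarrow> \<tau> j + 1 = \<lfloor>x / real N\<rfloor>" for x j
    unfolding D_def using N by (intro floor_interval_iff) simp
  have "u j \<in> V g 1 b (\<nu> j)" if j: "j \<in> J" for j
  proof (rule supported_in_V)
    show "u j \<in> L2" unfolding u_def D_def by (intro restrict_L2 f) auto
    have "real_of_int (int N * \<tau> j) \<le> of_int (\<nu> j)" "real_of_int (\<nu> j) \<le> of_int (int N * \<tau> j + int N)"
      using \<nu>[OF j] by (simp_all only: of_int_le_iff)
    then have "D j \<subseteq> {of_int (\<nu> j)..<of_int (\<nu> j) + 2 * real N}"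
      unfolding D_def by (auto simp: algebra_simps)
    then show "u j x = 0" if "x \<notin> {of_int (\<nu> j)..<of_int (\<nu> j) + 2 * real N}" for x
      using that by (auto simp: u_def indicator_def)
  qed
  moreover have "l2_has_sum u f J"
  proof -
    \<comment> \<open>The pieces have disjoint supports, so the remainder is computed exactly and
      unconditional convergence reduces to that of the integrals.\<close>
    have norm: "l2_norm (\<lambda>x. f x - (\<Sum>j\<in>X. u j x)) = sqrt ((l2_norm f)\<^sup>2 - sum ?E X)"
      if X: "finite X" "X \<subseteq> J" for X
    proof -
      have pt: "(cmod (f x - (\<Sum>j\<in>X. u j x)))\<^sup>2
          = (cmod (f x))\<^sup>2 - (\<Sum>j\<in>X. indicator (D j) x *\<^sub>R (cmod (f x))\<^sup>2)" for x
      proof (cases "\<exists>j\<in>X. x \<in> D j")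
        case True
        then obtain i where i: "i \<in> X" "x \<in> D i" by blast
        have "x \<in> D j \<longleftrightarrow> j = i" if "j \<in> X" for j
        proof -
          have "x \<in> D j \<longleftrightarrow> \<tau> j = \<tau> i" using D[of x j] D[of x i] i(2) by auto
          also have "\<dots> \<longleftrightarrow> j = i"
            using i(1) that X(2) bij_betw_imp_inj_on[OF bij] by (auto simp: inj_on_eq_iff subset_iff)
          finally show ?thesis .
        qed
        then have ind: "indicator (D j) x = (if j = i then 1 else 0 :: 'r::zero_neq_one)" if "j \<in> X" for j
          using that by (simp add: indicator_def)
        have "(\<Sum>j\<in>X. u j x) = (\<Sum>j\<in>X. if j = i then f x else 0)"
          unfolding u_def by (intro sum.cong) (auto simp: ind)
        moreover have "(\<Sum>j\<in>X. indicator (D j) x *\<^sub>R (cmod (f x))\<^sup>2) = (\<Sum>j\<in>X. if j = i then (cmod (f x))\<^sup>2 else 0)"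
          by (intro sum.cong) (auto simp: ind)
        ultimately show ?thesis using i X(1) by simp
      next
        case False
        then show ?thesis by (simp add: u_def)
      qed
      have int: "integrable lborel (\<lambda>x. indicator (D j) x *\<^sub>R (cmod (f x))\<^sup>2)" for j
        unfolding D_def by (intro integrable_mult_indicator L2_D(2) f) auto
      have "(l2_norm (\<lambda>x. f x - (\<Sum>j\<in>X. u j x)))\<^sup>2 = (l2_norm f)\<^sup>2 - sum ?E X"
        unfolding l2_norm_sq pt set_lebesgue_integral_def
        by (simp only: Bochner_Integration.integral_diff[OF L2_D(2)[OF f] Bochner_Integration.integrable_sum[OF int]]
            Bochner_Integration.integral_sum[OF int])
      then show ?thesis by (metis l2_norm_nonneg real_sqrt_abs abs_of_nonneg)
    qed
    have bij': "bij_betw (\<lambda>j. \<tau> j + 1) J UNIV"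
    proof -
      have "bij_betw (\<lambda>n::int. n + 1) UNIV UNIV" by (rule bij_betwI[of _ _ _ "\<lambda>n. n - 1"]) auto
      from bij_betw_trans[OF bij this] show ?thesis by (simp add: o_def)
    qed
    have "(?E has_sum (l2_norm f)\<^sup>2) J"
      using has_sum_reindex_bij_betw[OF bij', THEN iffD2, OF has_sum_integral_intervals[OF L2_D(2)[OF f], of "real N"]] N
      by (simp add: D_def l2_norm_sq)
    then have "((\<lambda>X. sqrt ((l2_norm f)\<^sup>2 - sum ?E X)) \<longlongrightarrow> sqrt ((l2_norm f)\<^sup>2 - (l2_norm f)\<^sup>2)) (finite_subsets_at_top J)"
      unfolding has_sum_def by (intro tendsto_intros)
    moreover have "\<forall>\<^sub>F X in finite_subsets_at_top J.
        sqrt ((l2_norm f)\<^sup>2 - sum ?E X) = l2_norm (\<lambda>x. f x - (\<Sum>j\<in>X. u j x))"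
      by (rule eventually_finite_subsets_at_top_weakI) (simp add: norm)
    ultimately show ?thesis
      unfolding l2_has_sum_def by (auto dest: tendsto_cong[THEN iffD1, rotated])
  qed
  ultimately show "\<exists>u. (\<forall>j\<in>J. u j \<in> V g 1 b (\<nu> j)) \<and> l2_has_sum u f J" by blast
qed

text \<open>Whichever l in 1..N is selected at n, the window starts between N n and N n + N. The
  parts form a partition, so each n is selected exactly once and the second component is a bijection
  onto the integers.\<close>

lemma woven: "woven N (UNIV :: int set) (\<lambda>l n. V g 1 b (int N * n + int l - 1))"
  unfolding woven_def
proof (intro conjI ballI allI impI)
  fix l assume "l \<in> {1..N}"
  then show "information_packet UNIV (\<lambda>n. V g 1 b (int N * n + int l - 1))"
    by (intro information_packet_selection[where \<tau> = "\<lambda>n. n"]) (auto simp: bij_betw_def)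
next
  fix \<sigma> :: "nat \<Rightarrow> int set"
  assume \<sigma>: "disjoint_family_on \<sigma> {1..N} \<and> (\<Union>k\<in>{1..N}. \<sigma> k) = UNIV"
  have "bij_betw snd (Sigma {1..N} \<sigma>) UNIV"
    unfolding bij_betw_def
  proof
    show "inj_on snd (Sigma {1..N} \<sigma>)"
    proof (rule inj_onI)
      fix p p' assume p: "p \<in> Sigma {1..N} \<sigma>" "p' \<in> Sigma {1..N} \<sigma>" "snd p = snd p'"
      then have "snd p \<in> \<sigma> (fst p) \<inter> \<sigma> (fst p')" "fst p \<in> {1..N}" "fst p' \<in> {1..N}" by auto
      then have "fst p = fst p'" using \<sigma> unfolding disjoint_family_on_def by blast
      then show "p = p'" using p(3) by (simp add: prod_eq_iff)
    qed
    show "snd ` Sigma {1..N} \<sigma> = UNIV"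
    proof (intro equalityI subsetI UNIV_I)
      fix n :: int
      obtain k where "k \<in> {1..N}" "n \<in> \<sigma> k" using \<sigma> by blast
      then show "n \<in> snd ` Sigma {1..N} \<sigma>" by (intro image_eqI[of _ _ "(k, n)"]) auto
    qed
  qed
  then have "information_packet (Sigma {1..N} \<sigma>) (\<lambda>j. V g 1 b (int N * snd j + int (fst j) - 1))"
    by (rule information_packet_selection) auto
  then show "information_packet (Sigma {1..N} \<sigma>) (\<lambda>(l, n). V g 1 b (int N * n + int l - 1))"
    by (simp add: case_prod_unfold)
qed

end

theorem mainTheorem2:
  "(\<forall>N::nat. N \<ge> 2 \<longrightarrow>
      (\<exists>a b :: real. \<exists>g. a > 0 \<and> b > 0 \<and> g \<in> L2 \<and> gabor_frame g a b \<and>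
         woven N (UNIV :: int set) (\<lambda>l n. V g a b (int N * n + int l - 1)))) \<and>
   \<not> (\<exists>a b :: real. \<exists>g. a > 0 \<and> b > 0 \<and> g \<in> L2 \<and> gabor_frame g a b \<and>
         (\<forall>N::nat. N \<ge> 2 \<longrightarrow>
            woven N (UNIV :: int set) (\<lambda>l n. V g a b (int N * n + int l - 1))))"
proof (intro conjI allI impI notI)
  fix N :: nat assume "N \<ge> 2"
  then interpret rectangular_window N by unfold_locales simp
  show "\<exists>a b :: real. \<exists>g. a > 0 \<and> b > 0 \<and> g \<in> L2 \<and> gabor_frame g a b \<and>
         woven N (UNIV :: int set) (\<lambda>l n. V g a b (int N * n + int l - 1))"
    using b g_L2 frame woven by (intro exI[of _ 1] exI[of _ b] exI[of _ g]) simp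
next
  assume "\<exists>a b :: real. \<exists>g. a > 0 \<and> b > 0 \<and> g \<in> L2 \<and> gabor_frame g a b \<and>
         (\<forall>N::nat. N \<ge> 2 \<longrightarrow>
            woven N (UNIV :: int set) (\<lambda>l n. V g a b (int N * n + int l - 1)))"
  then obtain a b :: real and g where ab: "a > 0" "b > 0" and g: "g \<in> L2" "gabor_frame g a b"
    and woven: "\<And>N::nat. N \<ge> 2 \<Longrightarrow>
            woven N (UNIV :: int set) (\<lambda>l n. V g a b (int N * n + int l - 1))"
    by blast
  obtain M :: nat where M: "1 < real M * (a * b)"
    using reals_Archimedean3[of "a * b"] ab by auto
  \<comment> \<open>The Archimedean M may be 1; adding 2 secures N \<ge> 2 and keeps the product
    above 1.\<close>
  have "real M * (a * b) \<le> real (M + 2) * (a * b)"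
    using ab by (intro mult_right_mono) auto
  then have "1 < real (M + 2) * (a * b)" using M by linarith
  then show False
    by (rule not_woven_large[OF g(2) ab g(1) _ woven]) simp
qed

end
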